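(* For $|q|<1$, with sums over $i,j,k\in\mathbb{Z}_{\ge0}$, \begin{align*} \sum \frac{q^{2i^2+j^2+\frac{1}{2}k^2+2ij+ik-i-j+\frac{1}{2}k}}{(q;q)_i(q;q)_j(q;q)_k}&=2\frac{(q^2;q^2)_\infty^2}{(q;q)_\infty^2}, \\ \sum\frac{q^{2i^2+j^2+\frac{1}{2}k^2+2ij+ik-\frac{1}{2}j+\frac{1}{2}k}}{(q;q)_i(q;q)_j(q;q)_k}&=\frac{1}{(q^{\frac{1}{2}};q)_\infty}, \\ \sum \frac{q^{2i^2+j^2+\frac{1}{2}k^2+2ij+ik+i+\frac{1}{2}k}}{(q;q)_i(q;q)_j(q;q)_k} &=\frac{(q^2;q^2)_\infty^2}{(q;q)_\infty^2}, \\ \sum\frac{q^{2i^2+j^2+\frac{1}{2}k^2+2ij+ik+\frac{1}{2}k}}{(q;q)_i(q;q)_j(q;q)_k}&=\frac{(q^2;q^2)_\infty (q^3;q^3)_\infty^2}{(q;q)_\infty^2 (q^6;q^6)_\infty}, \\ \sum\frac{q^{2i^2+j^2+\frac{1}{2}k^2+2ij+ik+2i+j+\frac{1}{2}k}}{(q;q)_i(q;q)_j(q;q)_k}&=\frac{(q^6;q^6)_\infty^2}{(q;q)_\infty (q^3;q^3)_\infty}, \\ \sum\frac{q^{4i^2+2j^2+k^2+4ij+2ik}}{(q^2;q^2)_i(q^2;q^2)_j(q^2;q^2)_k}&=\frac{1}{(q,q^3,q^4,q^8,q^9,q^{11};q^{12})_\infty},\\ \sum\frac{q^{4i^2+2j^2+k^2+4ij+2ik+4i+2j+2k}}{(q^2;q^2)_i(q^2;q^2)_j(q^2;q^2)_k}&=\frac{1}{(q^3,q^4,q^5,q^7,q^8,q^9;q^{12})_\infty}.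 \end{align*}
   Context: For $|q|<1$: $(a;q)_n=\prod_{k=0}^{n-1}(1-aq^k)$ ($(a;q)_0=1$), $(a;q)_\infty=\prod_{k\ge0}(1-aq^k)$, $(a_1,\dots,a_m;q)_\infty=\prod_\ell(a_\ell;q)_\infty$. Half-integer powers of $q$ use a fixed choice of $q^{1/2}$ (e.g. $0<q<1$). *)

theory Defs
  imports "HOL-Analysis.Analysis"
begin

definition qpoch :: "complex \<Rightarrow> complex \<Rightarrow> nat \<Rightarrow> complex" where
  "qpoch a q n = (\<Prod>k<n. 1 - a * q ^ k)"

definition qpoch_inf :: "complex \<Rightarrow> complex \<Rightarrow> complex" where
  "qpoch_inf a q = (\<Prod>k. 1 - a * q ^ k)"

text \<open>Summand of the triple sums: s is a fixed square root of q, and the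
  exponent of q is e/2, so q^(e/2) = s^e (e is an integer).\<close>
definition tsum3 :: "complex \<Rightarrow> (nat \<Rightarrow> nat \<Rightarrow> nat \<Rightarrow> int) \<Rightarrow> nat \<times> nat \<times> nat \<Rightarrow> complex" where
  "tsum3 s e = (\<lambda>(i,j,k). s powi (e i j k) /
      (qpoch (s^2) (s^2) i * qpoch (s^2) (s^2) j * qpoch (s^2) (s^2) k))"

end

theory Submission
  imports Defs
begin

text \<open>
  Write \<open>p = s\<close> and \<open>q = p\<^sup>2\<close>; in the last two identities the original \<open>q\<close> plays the role of \<open>p\<close>.
  Euler's identity sums over \<open>k\<close> and leaves
  \<open>\<Sum> q\<^bsup>N\<^sup>2 + n\<^sup>2 + \<dots>\<^esup> \<beta>\<^sub>n / (q)\<^bsub>N-n\<^esub>\<close> with \<open>n = i\<close>, \<open>N = i + j\<close> and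
  \<open>\<beta>\<^sub>n\<close> one of \<open>1 / ((q)\<^sub>n (-q)\<^sub>n)\<close>, \<open>q\<^sup>n / ((q)\<^sub>n (-q)\<^sub>n)\<close>,
  \<open>1 / ((q)\<^sub>n (-p;q)\<^sub>n)\<close>, \<open>1 / ((q)\<^sub>n (-p;q)\<^bsub>n+1\<^esub>)\<close>.
  Each of these is \<open>\<Sum>\<^sub>r (-1)\<^sup>r p\<^bsup>2r\<^sup>2 + cr\<^esup> / ((q)\<^bsub>n-r\<^esub> (q)\<^bsub>n+r+e\<^esub>)\<close> over all integers
  \<open>r\<close> with \<open>e \<in> {0, 1}\<close>: the recurrences in \<open>n\<close> differ from the required ones by sums
  that are antisymmetric under \<open>r \<mapsto> -r\<close> or \<open>r \<mapsto> -1 - r\<close>. Two applications of the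
  \<open>q\<close>-Vandermonde sum (the Bailey lemma) turn the double sum into a theta series, which the Jacobi
  triple product evaluates.

  The second identity is different: collecting the terms with \<open>2i + j = m\<close> produces
  \<open>\<Sum>\<^sub>m p\<^bsup>m\<^sup>2\<^esup> / (q)\<^sub>m\<close>, because \<open>(-x;q)\<^sub>\<infinity> / (x\<^sup>2;q\<^sup>2)\<^sub>\<infinity> = 1 / (x;q)\<^sub>\<infinity>\<close>.
\<close>

section \<open>Infinite sums\<close>

text \<open>Dominated convergence for counting measure: on absolutely summable families
  \<open>infsum\<close> is the integral over \<open>count_space\<close>.\<close>

lemma infsum_dominated_convergence:
  fixes f :: "nat \<Rightarrow> 'a \<Rightarrow> complex" and h :: "'a \<Rightarrow> real"
  assumes h: "h summable_on UNIV"
    and le: "\<And>n x. norm (f n x) \<le> h x"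
    and lim: "\<And>x. (\<lambda>n. f n x) \<longlonglongrightarrow> g x"
  shows "(\<lambda>n. infsum (f n) UNIV) \<longlonglongrightarrow> infsum g UNIV" "g summable_on UNIV"
proof -
  have h0: "h x \<ge> 0" for x
    using order_trans[OF norm_ge_zero le[of 0 x]] .
  have hn: "(\<lambda>x. norm (h x)) summable_on UNIV"
    using h h0 by simp
  have int: "integrable (count_space UNIV) h"
    using abs_summable_equivalent[of h UNIV] hn
    by (simp add: Infinite_Set_Sum.abs_summable_on_def)
  have fs: "(\<lambda>x. norm (f n x)) summable_on UNIV" for n
    by (rule Infinite_Sum.abs_summable_on_comparison_test'[OF h]) (use le in auto)
  have "norm (g x) \<le> h x" for x
    by (rule LIMSEQ_le_const2[OF tendsto_norm[OF lim]]) (use le in auto)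
  then have gs: "(\<lambda>x. norm (g x)) summable_on UNIV"
    by (intro Infinite_Sum.abs_summable_on_comparison_test'[OF h]) auto
  then show "g summable_on UNIV"
    by (rule abs_summable_summable)
  have "(\<lambda>n. integral\<^sup>L (count_space UNIV) (f n)) \<longlonglongrightarrow> integral\<^sup>L (count_space UNIV) g"
    by (rule integral_dominated_convergence[OF _ _ int]) (use lim le in \<open>auto\<close>)
  then show "(\<lambda>n. infsum (f n) UNIV) \<longlonglongrightarrow> infsum g UNIV"
    unfolding infsetsum_infsum[unfolded infsetsum_def, OF abs_summable_equivalent[THEN iffD1, OF gs]]
      infsetsum_infsum[unfolded infsetsum_def, OF abs_summable_equivalent[THEN iffD1, OF fs]] .
qed

lemma has_sum_finite_sum:
  fixes f :: "'i \<Rightarrow> 'a \<Rightarrow> complex"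
  assumes "finite I" "\<And>i. i \<in> I \<Longrightarrow> (f i has_sum S i) A"
  shows "((\<lambda>x. \<Sum>i\<in>I. f i x) has_sum (\<Sum>i\<in>I. S i)) A"
  using assms by (induction I rule: finite_induct) (auto intro!: has_sum_add)

lemma summable_on_geometric_nat:
  fixes c :: real assumes "0 \<le> c" "c < 1"
  shows "(\<lambda>n::nat. c ^ n) summable_on UNIV"
  using assms by (intro summable_nonneg_imp_summable_on summable_geometric) auto

lemma bij_betw_int_atLeast: "bij_betw int UNIV {0..}"
  by (rule bij_betwI[of _ _ _ nat]) auto

text \<open>Turns bilateral sums back into sums over naturals; the vanishing comes from a reciprocal
  \<open>q\<close>-factorial at a negative index.\<close>

lemma has_sum_int_restrict_nat:
  fixes f :: "int \<Rightarrow> complex"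
  assumes "(f has_sum S) UNIV" "\<And>N. N < 0 \<Longrightarrow> f N = 0"
  shows "((\<lambda>N. f (int N)) has_sum S) UNIV"
proof -
  have "(f has_sum S) UNIV \<longleftrightarrow> (f has_sum S) {0..}"
    by (rule has_sum_cong_neutral) (use assms in auto)
  then show ?thesis
    using assms has_sum_reindex_bij_betw[OF bij_betw_int_atLeast, of f S] by simp
qed

lemma summable_on_int_if_nat:
  fixes f :: "int \<Rightarrow> real"
  assumes "(\<lambda>n. f (int n)) summable_on UNIV" "(\<lambda>n. f (- int n)) summable_on UNIV"
  shows "f summable_on UNIV"
proof -
  have "bij_betw (\<lambda>n. - int n) UNIV {..0}"
    by (rule bij_betwI[of _ _ _ "\<lambda>m. nat (- m)"]) auto
  then have "f summable_on {0..}" "f summable_on {..0}"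
    using assms summable_on_reindex_bij_betw[OF bij_betw_int_atLeast, of f]
      summable_on_reindex_bij_betw[of "\<lambda>n. - int n" UNIV "{..0}" f] by blast+
  then have "f summable_on ({0..} \<union> {..0})"
    by (rule summable_on_union)
  moreover have "{0..} \<union> {..0} = (UNIV :: int set)" by auto
  ultimately show ?thesis by simp
qed

section \<open>q-Pochhammer symbols\<close>

lemma qpoch_0 [simp]: "qpoch a q 0 = 1"
  by (simp add: qpoch_def)

lemma qpoch_Suc: "qpoch a q (Suc n) = qpoch a q n * (1 - a * q ^ n)"
  by (simp add: qpoch_def)

lemma qpoch_add: "qpoch a q (m + n) = qpoch a q m * qpoch (a * q ^ m) q n"
  by (induction n) (auto simp: qpoch_Suc power_add mult_ac)

text \<open>The factors are sorted by the residue class of the exponent modulo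
  \<open>m\<close>.\<close>

lemma qpoch_dissect: "qpoch a q (m * n) = (\<Prod>j<m. qpoch (a * q ^ j) (q ^ m) n)"
proof (induction n)
  case (Suc n)
  have "qpoch a q (m * Suc n) = qpoch a q (m * n) * qpoch (a * q ^ (m * n)) q m"
    by (simp add: add.commute qpoch_add[symmetric])
  also have "qpoch (a * q ^ (m * n)) q m = (\<Prod>j<m. 1 - a * q ^ j * (q ^ m) ^ n)"
    by (simp add: qpoch_def power_mult mult_ac)
  finally show ?case
    by (simp add: Suc qpoch_Suc prod.distrib)
qed simp

lemma qpoch_mult_minus: "qpoch a q n * qpoch (- a) q n = qpoch (a\<^sup>2) (q\<^sup>2) n"
  by (induction n) (simp_all add: qpoch_Suc power2_eq_square power_mult_distrib algebra_simps)

lemma convergent_prod_qpoch: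
  fixes a q :: complex
  assumes "norm q < 1"
  shows "convergent_prod (\<lambda>k. 1 - a * q ^ k)"
proof -
  have "summable (\<lambda>k. norm (- a * q ^ k))"
    using assms by (simp add: norm_mult norm_power summable_mult summable_geometric)
  then have "abs_convergent_prod (\<lambda>k. 1 + (- a * q ^ k))"
    by (intro summable_imp_abs_convergent_prod) simp
  then show ?thesis
    using abs_convergent_prod_imp_convergent_prod by fastforce
qed

lemma qpoch_LIMSEQ:
  assumes "norm q < 1"
  shows "qpoch a q \<longlonglongrightarrow> qpoch_inf a q"
proof -
  have "(\<lambda>n. \<Prod>k\<le>n. 1 - a * q ^ k) \<longlonglongrightarrow> qpoch_inf a q"
    unfolding qpoch_inf_def by (rule convergent_prod_LIMSEQ[OF convergent_prod_qpoch[OF assms]])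
  then have "(\<lambda>n. qpoch a q (Suc n)) \<longlonglongrightarrow> qpoch_inf a q"
    by (simp add: qpoch_def lessThan_Suc_atMost del: prod.lessThan_Suc)
  then show ?thesis by (rule filterlim_sequentially_Suc[THEN iffD1])
qed

lemma qpoch_factor_nonzero:
  fixes a q :: complex
  assumes "norm q < 1" "norm a < 1"
  shows "1 - a * q ^ k \<noteq> 0"
proof
  assume "1 - a * q ^ k = 0"
  then have "norm (a * q ^ k) = 1" by simp
  moreover have "norm (a * q ^ k) \<le> norm a * 1"
    unfolding norm_mult norm_power using assms by (intro mult_left_mono power_le_one) auto
  ultimately show False using assms by simp
qed

lemma qpoch_nonzero: "norm q < 1 \<Longrightarrow> norm a < 1 \<Longrightarrow> qpoch a q n \<noteq> 0"
  unfolding qpoch_def using qpoch_factor_nonzero by simp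

lemma qpoch_inf_nonzero: "norm q < 1 \<Longrightarrow> norm a < 1 \<Longrightarrow> qpoch_inf a q \<noteq> 0"
  unfolding qpoch_inf_def using qpoch_factor_nonzero
  by (intro prodinf_nonzero convergent_prod_qpoch)

lemma qpoch_inf_split:
  assumes "norm q < 1"
  shows "qpoch_inf a q = qpoch a q n * qpoch_inf (a * q ^ n) q"
proof (rule LIMSEQ_unique)
  show "(\<lambda>m. qpoch a q (m + n)) \<longlonglongrightarrow> qpoch_inf a q"
    by (rule LIMSEQ_ignore_initial_segment[OF qpoch_LIMSEQ[OF assms]])
  show "(\<lambda>m. qpoch a q (m + n)) \<longlonglongrightarrow> qpoch a q n * qpoch_inf (a * q ^ n) q"
    unfolding add.commute[of _ n] qpoch_add by (intro tendsto_mult tendsto_const qpoch_LIMSEQ assms)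
qed

lemma qpoch_inf_dissect:
  assumes "norm q < 1" "m > 0"
  shows "qpoch_inf a q = (\<Prod>j<m. qpoch_inf (a * q ^ j) (q ^ m))"
proof (rule LIMSEQ_unique)
  show "(\<lambda>n. qpoch a q (m * n)) \<longlonglongrightarrow> qpoch_inf a q"
    using LIMSEQ_subseq_LIMSEQ[OF qpoch_LIMSEQ[OF assms(1)], of "\<lambda>n. m * n"] assms(2)
    by (simp add: strict_mono_def o_def)
  have "norm (q ^ m) < 1"
    using assms by (simp add: norm_power power_less_one_iff)
  then show "(\<lambda>n. qpoch a q (m * n)) \<longlonglongrightarrow> (\<Prod>j<m. qpoch_inf (a * q ^ j) (q ^ m))"
    unfolding qpoch_dissect by (intro tendsto_prod qpoch_LIMSEQ)
qed

lemma qpoch_inf_mult_minus: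
  assumes "norm q < 1"
  shows "qpoch_inf a q * qpoch_inf (- a) q = qpoch_inf (a\<^sup>2) (q\<^sup>2)"
proof (rule LIMSEQ_unique)
  show "(\<lambda>n. qpoch (a\<^sup>2) (q\<^sup>2) n) \<longlonglongrightarrow> qpoch_inf a q * qpoch_inf (- a) q"
    unfolding qpoch_mult_minus[symmetric] by (intro tendsto_mult qpoch_LIMSEQ assms)
  show "(\<lambda>n. qpoch (a\<^sup>2) (q\<^sup>2) n) \<longlonglongrightarrow> qpoch_inf (a\<^sup>2) (q\<^sup>2)"
    using assms by (intro qpoch_LIMSEQ) (simp add: norm_power power_less_one_iff)
qed

section \<open>Reciprocal q-factorials at integer index\<close>

text \<open>The convention that \<open>1 / (q)\<^sub>m\<close> is zero for negative \<open>m\<close>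
  lets sums run over all integers, so shifts and reflections produce no boundary terms.\<close>

definition qfact_inv :: "complex \<Rightarrow> int \<Rightarrow> complex" where
  "qfact_inv q m = (if m < 0 then 0 else 1 / qpoch q q (nat m))"

lemma qfact_inv_neg [simp]: "m < 0 \<Longrightarrow> qfact_inv q m = 0"
  and qfact_inv_of_nat: "qfact_inv q (int n) = 1 / qpoch q q n"
  and qfact_inv_0 [simp]: "qfact_inv q 0 = 1"
  by (auto simp: qfact_inv_def)

text \<open>At \<open>m = 0\<close> the factor \<open>1 - q powi 0\<close> vanishes together with
  \<open>qfact_inv q (-1)\<close>, so the recurrence has no exceptional index.\<close>

lemma qfact_inv_rec:
  assumes "norm q < 1" "q \<noteq> 0"
  shows "(1 - q powi m) * qfact_inv q m = qfact_inv q (m - 1)"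
proof (cases "m \<le> 0")
  case True
  then show ?thesis by (cases "m = 0") auto
next
  case False
  then obtain n where n: "m = int (Suc n)"
    using zero_less_imp_eq_int[of m] gr0_conv_Suc by auto
  have "qpoch q q n \<noteq> 0" "1 - q * q ^ n \<noteq> 0"
    using assms qpoch_nonzero qpoch_factor_nonzero by auto
  then show ?thesis
    unfolding n qfact_inv_of_nat power_int_of_nat
    by (simp add: qfact_inv_of_nat qpoch_Suc)
qed

lemma qfact_inv_LIMSEQ:
  assumes "norm q < 1"
  shows "(\<lambda>n. qfact_inv q (int n + c)) \<longlonglongrightarrow> 1 / qpoch_inf q q"
\<comment> \<open>Dropping \<open>nat (-c)\<close> initial terms makes the index nonnegative, out of
  reach of the zero convention.\<close>
proof (rule LIMSEQ_offset[where k = "nat (-c)"])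
  have "(\<lambda>n. 1 / qpoch q q (n + nat (c + int (nat (-c))))) \<longlonglongrightarrow> 1 / qpoch_inf q q"
    using assms
    by (intro tendsto_divide tendsto_const LIMSEQ_ignore_initial_segment qpoch_LIMSEQ qpoch_inf_nonzero)
  moreover have "qfact_inv q (int (n + nat (-c)) + c) = 1 / qpoch q q (n + nat (c + int (nat (-c))))" for n
    by (auto simp: qfact_inv_def nat_add_distrib intro!: arg_cong[of _ _ "qpoch q q"])
  ultimately show "(\<lambda>n. qfact_inv q (int (n + nat (-c)) + c)) \<longlonglongrightarrow> 1 / qpoch_inf q q"
    by simp
qed

lemma qfact_inv_bounded:
  assumes "norm q < 1"
  obtains C where "C \<ge> 1" "\<And>m. norm (qfact_inv q m) \<le> C"
proof -
  have "Bseq (\<lambda>n. qfact_inv q (int n))"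
    using qfact_inv_LIMSEQ[OF assms, of 0] by (auto intro!: convergent_imp_Bseq convergentI)
  then obtain K where K: "\<And>n. norm (qfact_inv q (int n)) \<le> K"
    by (auto simp: Bseq_def)
  have "norm (qfact_inv q m) \<le> max 1 K" for m
    using K[of "nat m"] by (cases "m < 0") auto
  then show ?thesis using that[of "max 1 K"] by simp
qed

section \<open>Bilateral sums\<close>

lemma power_int_double: "(p ^ 2 :: complex) powi m = p powi (2 * m)"
  by (simp add: power_int_power)

text \<open>With \<open>a = n\<close> and \<open>b = n + e\<close> this is the
  \<open>\<beta>\<^sub>n\<close> of a Bailey pair relative to \<open>q\<^sup>e\<close>, where
  \<open>g\<close> is its \<open>\<alpha>\<close> spread over all integers. The two reciprocal
  factorials confine \<open>r\<close> to \<open>{-b..a}\<close>.\<close>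

definition bilat :: "complex \<Rightarrow> int \<Rightarrow> int \<Rightarrow> (int \<Rightarrow> complex) \<Rightarrow> complex" where
  "bilat q a b g = (\<Sum>\<^sub>\<infinity>r. g r * qfact_inv q (a - r) * qfact_inv q (b + r))"

lemma bilat_summable: "(\<lambda>r. g r * qfact_inv q (a - r) * qfact_inv q (b + r)) summable_on UNIV"
proof (rule finite_nonzero_values_imp_summable_on)
  have "{r \<in> UNIV. g r * qfact_inv q (a - r) * qfact_inv q (b + r) \<noteq> 0} \<subseteq> {-b..a}"
    by (auto simp: qfact_inv_def split: if_splits)
  then show "finite {r \<in> UNIV. g r * qfact_inv q (a - r) * qfact_inv q (b + r) \<noteq> 0}"
    by (rule finite_subset) simp
qed

lemma bilat_has_sum:
  "((\<lambda>r. g r * qfact_inv q (a - r) * qfact_inv q (b + r)) has_sum bilat q a b g) UNIV"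
  unfolding bilat_def using bilat_summable by (rule has_sum_infsum)

lemma bilat_add: "bilat q a b (\<lambda>r. f r + g r) = bilat q a b f + bilat q a b g"
  unfolding bilat_def
  by (subst infsum_add[symmetric, OF bilat_summable bilat_summable]) (simp add: algebra_simps)

lemma bilat_cmult: "bilat q a b (\<lambda>r. c * g r) = c * bilat q a b g"
  unfolding bilat_def by (subst infsum_cmult_right'[symmetric]) (simp add: mult_ac)

lemma bilat_diff: "bilat q a b (\<lambda>r. f r - g r) = bilat q a b f - bilat q a b g"
  using bilat_add[of q a b f "\<lambda>r. -1 * g r"] unfolding bilat_cmult by simp

lemma bilat_reflect: "bilat q a b g = bilat q b a (\<lambda>r. g (- r))"
  unfolding bilat_def
  by (rule infsum_reindex_bij_witness[of _ uminus uminus]) (auto simp: mult_ac)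

lemma bilat_shift: "bilat q a b g = bilat q (a - 1) (b + 1) (\<lambda>r. g (r + 1))"
  unfolding bilat_def
  by (rule infsum_reindex_bij_witness[of _ "\<lambda>r. r + 1" "\<lambda>r. r - 1"]) (auto simp: algebra_simps)

text \<open>The map \<open>r \<mapsto> -r - 1\<close> exchanges the weights of index
  \<open>n - r\<close> and \<open>n + 1 + r\<close>; it is a reflection followed by a shift. The sum
  therefore equals its own negative.\<close>

lemma bilat_antisym_odd:
  assumes "\<And>r. g (- r - 1) = - g r"
  shows "bilat q n (n + 1) g = 0"
proof -
  have "bilat q n (n + 1) g = bilat q n (n + 1) (\<lambda>r. g (- r - 1))"
    by (subst bilat_reflect, subst bilat_shift) simp
  also have "\<dots> = bilat q n (n + 1) (\<lambda>r. -1 * g r)"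
    using assms by simp
  finally show ?thesis unfolding bilat_cmult by simp
qed

lemma bilat_single: "bilat q 0 0 g = g 0"
proof -
  have "bilat q 0 0 g = infsum (\<lambda>r. g r * qfact_inv q (0 - r) * qfact_inv q (0 + r)) {0}"
    unfolding bilat_def by (rule infsum_cong_neutral) (auto simp: qfact_inv_def)
  then show ?thesis by simp
qed

text \<open>Dominated by \<open>norm (g r)\<close> times the square of a bound on
  \<open>qfact_inv\<close>. The limit \<open>B\<close> is left open so that \<open>b\<close> may
  stay fixed (Vandermonde, Euler) or grow with \<open>n\<close> (triple product).\<close>

lemma bilat_LIMSEQ:
  assumes q: "norm q < 1" and g: "(\<lambda>r. norm (g r)) summable_on UNIV"
    and b: "\<And>r. (\<lambda>n. qfact_inv q (b n + r)) \<longlonglongrightarrow> B r"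
  shows "(\<lambda>n. bilat q (int n) (b n) g) \<longlonglongrightarrow> (\<Sum>\<^sub>\<infinity>r. g r * (1 / qpoch_inf q q) * B r)"
    and "(\<lambda>r. g r * (1 / qpoch_inf q q) * B r) summable_on UNIV"
proof -
  obtain C where C: "C \<ge> 1" "\<And>m. norm (qfact_inv q m) \<le> C"
    using qfact_inv_bounded[OF q] by metis
  have h: "(\<lambda>r. norm (g r) * C * C) summable_on UNIV"
    using g by (intro summable_on_cmult_left)
  have le: "norm (g r * qfact_inv q (int n - r) * qfact_inv q (b n + r)) \<le> norm (g r) * C * C" for n r
    unfolding norm_mult using C by (intro mult_mono) auto
  have lim: "(\<lambda>n. g r * qfact_inv q (int n - r) * qfact_inv q (b n + r)) \<longlonglongrightarrow> g r * (1 / qpoch_inf q q) * B r" for r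
    using qfact_inv_LIMSEQ[OF q, of "- r"] by (intro tendsto_mult tendsto_const b) simp
  show "(\<lambda>n. bilat q (int n) (b n) g) \<longlonglongrightarrow> (\<Sum>\<^sub>\<infinity>r. g r * (1 / qpoch_inf q q) * B r)"
    and "(\<lambda>r. g r * (1 / qpoch_inf q q) * B r) summable_on UNIV"
    unfolding bilat_def using infsum_dominated_convergence[OF h le lim] by auto
qed

text \<open>Root test on each half: the \<open>n\<close>-th root of a term is
  \<open>norm z * norm p ^ n\<close>, with \<open>z = y\<close> for positive and
  \<open>z = inverse y\<close> for negative indices, and tends to zero.\<close>

lemma theta_norm_summable:
  fixes p y :: complex
  assumes p: "norm p < 1" "p \<noteq> 0" and y: "y \<noteq> 0"
  shows "(\<lambda>r. norm (y powi r * p powi (r\<^sup>2))) summable_on UNIV"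
proof -
  have *: "(\<lambda>n::nat. norm z ^ n * norm p ^ (n\<^sup>2)) summable_on UNIV" if "z \<noteq> 0" for z :: complex
  proof -
    have "summable (\<lambda>n::nat. norm z ^ n * norm p ^ (n\<^sup>2))"
    proof (rule root_test_convergence)
      show "(\<lambda>n. root n (norm (norm z ^ n * norm p ^ (n\<^sup>2)))) \<longlonglongrightarrow> norm z * 0"
      proof (rule Lim_transform_eventually)
        show "(\<lambda>n. norm z * norm p ^ n) \<longlonglongrightarrow> norm z * 0"
          using p by (intro tendsto_mult tendsto_const LIMSEQ_power_zero) auto
        show "\<forall>\<^sub>F n in sequentially. norm z * norm p ^ n = root n (norm (norm z ^ n * norm p ^ (n\<^sup>2)))"
          using eventually_gt_at_top[of 0]
        proof eventually_elim
          case (elim n)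
          have "norm (norm z ^ n * norm p ^ (n\<^sup>2)) = (norm z * norm p ^ n) ^ n"
            by (simp add: power_mult_distrib power2_eq_square power_mult norm_mult norm_power)
          then show ?case using elim by (simp add: real_root_power_cancel)
        qed
      qed
    qed simp
    then show ?thesis by (rule summable_nonneg_imp_summable_on) auto
  qed
  show ?thesis
  proof (rule summable_on_int_if_nat)
    have "norm (y powi int n * p powi (int n)\<^sup>2) = norm y ^ n * norm p ^ (n\<^sup>2)" for n
      by (simp add: norm_mult norm_power flip: of_nat_power)
    then show "(\<lambda>n. norm (y powi int n * p powi (int n)\<^sup>2)) summable_on UNIV"
      using *[OF y] by simp
    have "norm (y powi (- int n) * p powi (- int n)\<^sup>2) = norm (inverse y) ^ n * norm p ^ (n\<^sup>2)" for n
      by (simp add: norm_mult norm_power power_int_minus norm_inverse power_inverse flip: of_nat_power)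
    then show "(\<lambda>n. norm (y powi (- int n) * p powi (- int n)\<^sup>2)) summable_on UNIV"
      using *[of "inverse y"] y by simp
  qed
qed

lemma eq_recip_mult: "x * c = 1 / y \<Longrightarrow> c \<noteq> 0 \<Longrightarrow> x = 1 / (y * c)" for x :: complex
  by (metis divide_divide_eq_left nonzero_eq_divide_eq)

lemma minus_one_powi_reflect: "(-1 :: complex) powi (- r - 1) = - ((-1) powi r)"
  using power_int_minus_one_minus[of "r + 1", where 'a = complex] by (simp add: power_int_add)

text \<open>Twice the exponent of \<open>q\<close> in the first five sums, hence an exponent of
  \<open>p\<close>; in the last two sums it is the exponent of the original \<open>q\<close> itself.
  The seven sums differ only in \<open>A\<close>, \<open>B\<close>, \<open>C\<close>.\<close>

definition texp :: "int \<Rightarrow> int \<Rightarrow> int \<Rightarrow> nat \<Rightarrow> nat \<Rightarrow> nat \<Rightarrow> int" where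
  "texp A B C i j k = 4 * (int i)\<^sup>2 + 2 * (int j)\<^sup>2 + (int k)\<^sup>2 + 4 * int i * int j + 2 * int i * int k
     + A * int i + B * int j + C * int k"

definition theta_term :: "complex \<Rightarrow> int \<Rightarrow> int \<Rightarrow> complex" where
  "theta_term p c r = (-1) powi r * p powi (2 * r\<^sup>2 + c * r)"

locale nome =
  fixes p :: complex
  assumes p_less: "norm p < 1" and p_nz: "p \<noteq> 0"
begin

abbreviation (input) "q \<equiv> p\<^sup>2"
abbreviation (input) "sq \<equiv> theta_term p"
abbreviation (input) "iq \<equiv> qfact_inv (p\<^sup>2)"

lemma q_less: "norm q < 1"
  using p_less by (simp add: norm_power power_less_one_iff)

lemma iq_rec: "(1 - p powi (2 * m)) * iq m = iq (m - 1)"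
  using qfact_inv_rec[of q m] q_less p_nz by (simp add: power_int_double)

lemma powi_add: "p powi (m + n) = p powi m * p powi n"
  using p_nz by (simp add: power_int_add)

lemma one_minus_powi_nonzero: "m > 0 \<Longrightarrow> 1 - p powi m \<noteq> 0"
proof
  assume m: "m > 0" and "1 - p powi m = 0"
  then have "norm (p ^ nat m) = 1" by (simp add: power_int_def)
  moreover have "norm (p ^ nat m) < 1"
    using m p_less by (simp add: norm_power power_less_one_iff)
  ultimately show False by simp
qed

text \<open>The recurrence of \<open>iq\<close> trades a lowered index for a factor in the
  coefficient, so that sums with different indices can be compared term by term.
  \<open>bilat_right\<close> does the same for \<open>b\<close>.\<close>

lemma bilat_left: "bilat q (a - 1) b g = bilat q a b (\<lambda>r. (1 - p powi (2 * (a - r))) * g r)"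
proof -
  have *: "iq (a - 1 - r) = (1 - p powi (2 * (a - r))) * iq (a - r)" for r
    by (subst iq_rec) (simp add: algebra_simps)
  show ?thesis unfolding bilat_def * by (simp add: mult_ac)
qed

lemma bilat_right: "bilat q a (b - 1) g = bilat q a b (\<lambda>r. (1 - p powi (2 * (b + r))) * g r)"
proof -
  have *: "iq (b - 1 + r) = (1 - p powi (2 * (b + r))) * iq (b + r)" for r
    by (subst iq_rec) (simp add: algebra_simps)
  show ?thesis unfolding bilat_def * by (simp add: mult_ac)
qed

section \<open>q-Vandermonde, Euler and the Jacobi triple product\<close>

lemma q_vandermonde: "bilat q M d (\<lambda>k. p powi (2 * k * (k + d)) * iq k) = iq M * iq (M + d)"
proof (cases "M < 0")
  case True
  then have "bilat q M d (\<lambda>k. p powi (2 * k * (k + d)) * iq k) = 0"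
    unfolding bilat_def by (intro infsum_0) (auto simp: qfact_inv_def)
  then show ?thesis using True by simp
next
  case False
  define n where "n = nat M"
  have "bilat q (int n) d (\<lambda>k. p powi (2 * k * (k + d)) * iq k) = iq (int n) * iq (int n + d)"
  proof (induction n arbitrary: d)
    case 0
    have "bilat q (int 0) d (\<lambda>k. p powi (2 * k * (k + d)) * iq k)
      = (\<Sum>\<^sub>\<infinity>k\<in>{0}. p powi (2 * k * (k + d)) * iq k * iq (int 0 - k) * iq (d + k))"
      unfolding bilat_def by (rule infsum_cong_neutral) (auto simp: qfact_inv_def)
    then show ?case by simp
  next
    case (Suc n)
    define M where "M = int (Suc n)"
    let ?V = "\<lambda>M d. bilat q M d (\<lambda>k. p powi (2 * k * (k + d)) * iq k)"
    have split: "(1 - p powi (2 * M)) * (p powi (2 * k * (k + d)) * iq k)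
      = (1 - p powi (2 * (M - k))) * (p powi (2 * k * (k + d)) * iq k)
        + p powi (2 * (M - k) + 2 * k * (k + d)) * iq (k - 1)" for k
      unfolding iq_rec[of k, symmetric]
      using powi_add[of "2 * (M - k)" "2 * k"] powi_add[of "2 * (M - k)" "2 * k * (k + d)"]
      by (simp add: algebra_simps)
    have "(1 - p powi (2 * M)) * ?V M d
      = bilat q (M - 1) d (\<lambda>k. p powi (2 * k * (k + d)) * iq k)
        + bilat q M d (\<lambda>k. p powi (2 * (M - k) + 2 * k * (k + d)) * iq (k - 1))"
      unfolding bilat_cmult[symmetric] split bilat_add bilat_left ..
    also have "bilat q M d (\<lambda>k. p powi (2 * (M - k) + 2 * k * (k + d)) * iq (k - 1))
       = bilat q (M - 1) (d + 1) (\<lambda>k. p powi (2 * (M + d)) * (p powi (2 * k * (k + (d + 1))) * iq k))"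
      by (subst bilat_shift) (simp add: powi_add[symmetric] algebra_simps flip: mult.assoc)
    also have "\<dots> = p powi (2 * (M + d)) * ?V (M - 1) (d + 1)"
      by (rule bilat_cmult)
    also have "?V (M - 1) d + p powi (2 * (M + d)) * ?V (M - 1) (d + 1)
      = iq (M - 1) * (iq (M + d - 1) + p powi (2 * (M + d)) * iq (M + d))"
    proof -
      have "M - 1 = int n" by (simp add: M_def)
      then show ?thesis
        unfolding \<open>M - 1 = int n\<close> Suc by (simp add: M_def algebra_simps)
    qed
    also have "\<dots> = (1 - p powi (2 * M)) * (iq M * iq (M + d))"
      unfolding iq_rec[symmetric] by (simp add: algebra_simps)
    finally show ?case
      using one_minus_powi_nonzero[of "2 * M"] by (simp add: M_def del: of_nat_Suc)
  qed
  then show ?thesis using False by (simp add: n_def)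
qed

text \<open>The limit \<open>M \<longrightarrow> \<infinity>\<close> of
  \<open>q_vandermonde\<close>; one factor \<open>1 / qpoch_inf q q\<close> cancels.\<close>

lemma vandermonde_inf:
  "((\<lambda>k. p powi (2 * k * (k + d)) * iq k * iq (d + k)) has_sum 1 / qpoch_inf q q) UNIV"
proof -
  obtain C where C: "C \<ge> 1" "\<And>m. norm (iq m) \<le> C"
    using qfact_inv_bounded[OF q_less] by metis
  define g where "g = (\<lambda>k. p powi (2 * k * (k + d)) * iq k)"
  have "(\<lambda>k. norm ((p powi (2 * d)) powi k * q powi (k\<^sup>2)) * C) summable_on UNIV"
    using p_nz q_less by (intro summable_on_cmult_left theta_norm_summable) auto
  moreover have "norm (g k) \<le> norm ((p powi (2 * d)) powi k * q powi (k\<^sup>2)) * C" for k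
  proof -
    have "p powi (2 * k * (k + d)) = (p powi (2 * d)) powi k * q powi (k\<^sup>2)"
    proof -
      have "2 * k * (k + d) = 2 * d * k + 2 * k\<^sup>2"
        by (simp add: power2_eq_square algebra_simps)
      then show ?thesis
        by (simp only: powi_add power_int_double power_int_mult[symmetric])
    qed
    then show ?thesis unfolding g_def norm_mult using C by (intro mult_mono) (auto simp: norm_mult)
  qed
  ultimately have g: "(\<lambda>k. norm (g k)) summable_on UNIV"
    by (rule Infinite_Sum.abs_summable_on_comparison_test')
  have nz: "qpoch_inf q q \<noteq> 0"
    using q_less by (intro qpoch_inf_nonzero)
  have "(\<lambda>n. bilat q (int n) d g) \<longlonglongrightarrow> (\<Sum>\<^sub>\<infinity>k. g k * (1 / qpoch_inf q q) * iq (d + k))"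
   and s: "(\<lambda>k. g k * (1 / qpoch_inf q q) * iq (d + k)) summable_on UNIV"
    using bilat_LIMSEQ[OF q_less g, of "\<lambda>_. d"] by auto
  moreover have "(\<lambda>n. bilat q (int n) d g) \<longlonglongrightarrow> (1 / qpoch_inf q q) * (1 / qpoch_inf q q)"
    unfolding g_def q_vandermonde
    using qfact_inv_LIMSEQ[OF q_less, of 0] qfact_inv_LIMSEQ[OF q_less, of d]
    by (intro tendsto_mult) auto
  ultimately have "(\<Sum>\<^sub>\<infinity>k. g k * (1 / qpoch_inf q q) * iq (d + k)) = (1 / qpoch_inf q q) * (1 / qpoch_inf q q)"
    using LIMSEQ_unique by blast
  with s have "((\<lambda>k. g k * (1 / qpoch_inf q q) * iq (d + k)) has_sum (1 / qpoch_inf q q) * (1 / qpoch_inf q q)) UNIV"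
    by (simp add: has_sum_iff)
  then have "((\<lambda>k. qpoch_inf q q * (g k * (1 / qpoch_inf q q) * iq (d + k))) has_sum
      qpoch_inf q q * ((1 / qpoch_inf q q) * (1 / qpoch_inf q q))) UNIV"
    by (rule has_sum_cmult_right)
  then show ?thesis using nz by (simp add: g_def)
qed

section \<open>Finite triple product, Euler's identity and Jacobi's identity\<close>

lemma theta_finite_step:
  assumes "y \<noteq> 0"
  shows "(1 - p powi (2 * (a + b))) * bilat q a b (\<lambda>r. y powi r * p powi r\<^sup>2)
    = (1 + y * p powi (2 * a - 1)) * bilat q (a - 1) b (\<lambda>r. y powi r * p powi r\<^sup>2)"
proof -
  let ?g = "\<lambda>r. y powi r * p powi r\<^sup>2"
  have split: "(1 - p powi (2 * (a + b))) * ?g r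
    = (1 - p powi (2 * (a - r))) * ?g r
      + (1 - p powi (2 * (b + r))) * (y powi r * p powi (r\<^sup>2 + 2 * (a - r)))" for r
    using powi_add[of "2 * (a - r)" "2 * (b + r)"] powi_add[of "r\<^sup>2" "2 * (a - r)"]
    by (simp add: algebra_simps)
  have "(1 - p powi (2 * (a + b))) * bilat q a b ?g
     = bilat q (a - 1) b ?g + bilat q a (b - 1) (\<lambda>r. y powi r * p powi (r\<^sup>2 + 2 * (a - r)))"
    unfolding bilat_cmult[symmetric] split bilat_add bilat_left bilat_right ..
  also have "bilat q a (b - 1) (\<lambda>r. y powi r * p powi (r\<^sup>2 + 2 * (a - r)))
     = bilat q (a - 1) b (\<lambda>r. (y * p powi (2 * a - 1)) * ?g r)"
  proof (subst bilat_shift)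
    have "y powi (r + 1) * p powi ((r + 1)\<^sup>2 + 2 * (a - (r + 1))) = (y * p powi (2 * a - 1)) * ?g r" for r
    proof -
      have "(r + 1)\<^sup>2 + 2 * (a - (r + 1)) = (2 * a - 1) + r\<^sup>2"
        by (simp add: power2_eq_square algebra_simps)
      then show ?thesis using assms by (simp only: powi_add power_int_add_1) (simp add: power_int_add mult_ac)
    qed
    then show "bilat q (a - 1) (b - 1 + 1) (\<lambda>r. y powi (r + 1) * p powi ((r + 1)\<^sup>2 + 2 * (a - (r + 1))))
      = bilat q (a - 1) b (\<lambda>r. (y * p powi (2 * a - 1)) * ?g r)" by simp
  qed
  finally show ?thesis unfolding bilat_cmult by (simp add: algebra_simps)
qed

lemma theta_finite_induct:
  assumes "y \<noteq> 0"
  shows "bilat q (int a) (int b) (\<lambda>r. y powi r * p powi r\<^sup>2) * iq (int b)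
     = qpoch (- y * p) q a * iq (int a + int b) * bilat q 0 (int b) (\<lambda>r. y powi r * p powi r\<^sup>2)"
proof (induction a)
  case (Suc a)
  let ?T = "\<lambda>a. bilat q a (int b) (\<lambda>r. y powi r * p powi r\<^sup>2)"
  let ?m = "int (Suc a) + int b"
  have "(1 - p powi (2 * ?m)) * (?T (int (Suc a)) * iq (int b))
    = (1 + y * p powi (2 * int (Suc a) - 1)) * (?T (int a) * iq (int b))"
    using theta_finite_step[OF assms, of "int (Suc a)" "int b"] by simp
  also have "p powi (2 * int (Suc a) - 1) = p * q ^ a"
    using p_nz powi_add[of 1 "int (2 * a)"] unfolding power_int_of_nat by (simp add: power_mult)
  also have "(1 + y * (p * q ^ a)) * (?T (int a) * iq (int b))
     = qpoch (- y * p) q (Suc a) * iq (?m - 1) * ?T 0"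
    unfolding Suc by (simp add: qpoch_Suc algebra_simps)
  also have "\<dots> = (1 - p powi (2 * ?m)) * (qpoch (- y * p) q (Suc a) * iq ?m * ?T 0)"
    unfolding iq_rec[symmetric] by (simp add: mult_ac)
  finally show ?case
    using one_minus_powi_nonzero[of "2 * ?m"] by simp
qed (simp add: mult.commute)

lemma theta_finite_0:
  assumes "y \<noteq> 0"
  shows "bilat q (int a) 0 (\<lambda>r. y powi r * p powi r\<^sup>2) = qpoch (- y * p) q a * iq (int a)"
  using theta_finite_induct[OF assms, of a 0] by (simp add: bilat_single)

text \<open>A finite form of the triple product. Induction on \<open>a\<close> builds one Pochhammer
  symbol; the remaining sum with \<open>a = 0\<close> is reflected into the same shape with
  \<open>inverse y\<close>, which builds the other.\<close>

lemma theta_finite: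
  assumes "y \<noteq> 0"
  shows "bilat q (int a) (int b) (\<lambda>r. y powi r * p powi r\<^sup>2)
    = qpoch (- y * p) q a * qpoch (- p / y) q b * iq (int a + int b)"
proof -
  have "bilat q 0 (int b) (\<lambda>r. y powi r * p powi r\<^sup>2) = bilat q (int b) 0 (\<lambda>r. (inverse y) powi r * p powi r\<^sup>2)"
    by (subst bilat_reflect) (simp add: power_int_minus power_int_inverse)
  also have "\<dots> = qpoch (- p / y) q b * iq (int b)"
    using theta_finite_0[of "inverse y" b] assms by (simp add: field_simps)
  finally have "bilat q (int a) (int b) (\<lambda>r. y powi r * p powi r\<^sup>2) * iq (int b)
    = (qpoch (- y * p) q a * qpoch (- p / y) q b * iq (int a + int b)) * iq (int b)"
    unfolding theta_finite_induct[OF assms] by (simp add: mult_ac)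
  moreover have "iq (int b) \<noteq> 0"
    using qpoch_nonzero[OF q_less q_less] by (simp add: qfact_inv_of_nat)
  ultimately show ?thesis by simp
qed

text \<open>The finite triple product with \<open>b = 0\<close> and
  \<open>a \<longrightarrow> \<infinity>\<close>; the fixed factor \<open>iq r\<close> removes all
  negative \<open>r\<close>.\<close>

lemma euler_has_sum:
  assumes "y \<noteq> 0"
  shows "((\<lambda>k. y ^ k * p ^ (k\<^sup>2) / qpoch q q k) has_sum qpoch_inf (- y * p) q) UNIV"
proof -
  let ?g = "\<lambda>r. y powi r * p powi r\<^sup>2"
  have nz: "qpoch_inf q q \<noteq> 0"
    using q_less by (intro qpoch_inf_nonzero)
  have "(\<lambda>n. bilat q (int n) 0 ?g) \<longlonglongrightarrow> (\<Sum>\<^sub>\<infinity>r. ?g r * (1 / qpoch_inf q q) * iq (0 + r))"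
   and s: "(\<lambda>r. ?g r * (1 / qpoch_inf q q) * iq (0 + r)) summable_on UNIV"
    using bilat_LIMSEQ[OF q_less theta_norm_summable[OF p_less p_nz assms], of "\<lambda>_. 0"] by auto
  moreover have "(\<lambda>n. bilat q (int n) 0 ?g) \<longlonglongrightarrow> qpoch_inf (- y * p) q * (1 / qpoch_inf q q)"
    unfolding theta_finite_0[OF assms] using qfact_inv_LIMSEQ[OF q_less, of 0]
    by (intro tendsto_mult qpoch_LIMSEQ q_less) auto
  ultimately have "(\<Sum>\<^sub>\<infinity>r. ?g r * (1 / qpoch_inf q q) * iq (0 + r)) = qpoch_inf (- y * p) q * (1 / qpoch_inf q q)"
    using LIMSEQ_unique by blast
  with s have "((\<lambda>r. ?g r * (1 / qpoch_inf q q) * iq (0 + r)) has_sum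
      qpoch_inf (- y * p) q * (1 / qpoch_inf q q)) UNIV"
    by (simp add: has_sum_iff)
  from has_sum_cmult_right[OF this, of "qpoch_inf q q"]
  have "((\<lambda>r. ?g r * iq r) has_sum qpoch_inf (- y * p) q) UNIV"
    using nz by simp
  then have "((\<lambda>k. ?g (int k) * iq (int k)) has_sum qpoch_inf (- y * p) q) UNIV"
    by (rule has_sum_int_restrict_nat) simp
  then show ?thesis
    by (simp add: qfact_inv_of_nat flip: of_nat_power)
qed

text \<open>The finite triple product with \<open>a = b = n\<close> and
  \<open>n \<longrightarrow> \<infinity>\<close>.\<close>

lemma jacobi_triple_product:
  assumes "y \<noteq> 0"
  shows "((\<lambda>r. y powi r * p powi r\<^sup>2) has_sum
    qpoch_inf q q * qpoch_inf (- y * p) q * qpoch_inf (- p / y) q) UNIV"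
proof -
  let ?g = "\<lambda>r. y powi r * p powi r\<^sup>2" and ?i = "1 / qpoch_inf q q"
  have nz: "qpoch_inf q q \<noteq> 0"
    using q_less by (intro qpoch_inf_nonzero)
  have "(\<lambda>n. bilat q (int n) (int n) ?g) \<longlonglongrightarrow> (\<Sum>\<^sub>\<infinity>r. ?g r * ?i * ?i)"
   and s: "(\<lambda>r. ?g r * ?i * ?i) summable_on UNIV"
    using bilat_LIMSEQ[OF q_less theta_norm_summable[OF p_less p_nz assms] qfact_inv_LIMSEQ[OF q_less]] by auto
  moreover have "(\<lambda>n. iq (int n + int n)) \<longlonglongrightarrow> ?i"
    using LIMSEQ_subseq_LIMSEQ[OF qfact_inv_LIMSEQ[OF q_less, of 0], of "\<lambda>n. n + n"]
    by (simp add: strict_mono_def o_def)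
  then have "(\<lambda>n. bilat q (int n) (int n) ?g) \<longlonglongrightarrow> qpoch_inf (- y * p) q * qpoch_inf (- p / y) q * ?i"
    unfolding theta_finite[OF assms] by (intro tendsto_mult qpoch_LIMSEQ q_less)
  ultimately have "(\<Sum>\<^sub>\<infinity>r. ?g r * ?i * ?i) = qpoch_inf (- y * p) q * qpoch_inf (- p / y) q * ?i"
    using LIMSEQ_unique by blast
  with s have "((\<lambda>r. ?g r * ?i * ?i) has_sum qpoch_inf (- y * p) q * qpoch_inf (- p / y) q * ?i) UNIV"
    by (simp add: has_sum_iff)
  from has_sum_cmult_right[OF this, of "qpoch_inf q q * qpoch_inf q q"] nz show ?thesis
    by (simp add: mult_ac)
qed

section \<open>Bailey pairs\<close>

lemma powi_mult_theta_term: "p powi (m + k * r) * sq c r = p powi m * sq (c + k) r"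
  by (simp add: theta_term_def powi_add[symmetric] algebra_simps)

lemma theta_term_uminus: "sq c (- r) = sq (- c) r"
  by (simp add: theta_term_def power_int_minus_one_minus)

lemma theta_term_reflect: "sq c (- r - 1) = - (p powi (2 - c)) * sq (4 - c) r"
proof -
  have "2 * (- r - 1)\<^sup>2 + c * (- r - 1) = (2 - c) + (2 * r\<^sup>2 + (4 - c) * r)"
    by (simp add: power2_eq_square algebra_simps)
  then show ?thesis
    unfolding theta_term_def by (simp only: minus_one_powi_reflect powi_add) simp
qed

text \<open>\<open>c = 2\<close> is the fixed point of \<open>c \<mapsto> 4 - c\<close> in
  \<open>theta_term_reflect\<close>, and the factor there becomes \<open>-1\<close>.\<close>

lemma bilat_theta_term_2_odd: "bilat q n (n + 1) (sq 2) = 0"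
  by (rule bilat_antisym_odd) (simp add: theta_term_reflect)

lemma bilat_theta_term_2: "bilat q n n (sq 2) = p powi (2 * n) * bilat q n n (sq 0)"
proof -
  have "p powi (2 * n) * sq 0 r = p powi (2 * (n - r)) * sq 2 r" for r
    using powi_mult_theta_term[of "2 * n" "-2" r 2] by (simp add: algebra_simps)
  then have "bilat q n n (sq 2) - p powi (2 * n) * bilat q n n (sq 0)
    = bilat q n n (\<lambda>r. (1 - p powi (2 * (n - r))) * sq 2 r)"
    by (simp add: bilat_cmult[symmetric] bilat_diff[symmetric] algebra_simps)
  also have "\<dots> = bilat q (n - 1) n (sq 2)"
    by (simp add: bilat_left)
  also have "\<dots> = 0"
    using bilat_theta_term_2_odd[of "n - 1"] by simp
  finally show ?thesis by simp
qed

lemma bilat_theta_term_0_odd: "bilat q n (n + 1) (sq 0) = bilat q n n (sq 0)"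
proof -
  have *: "p powi (2 * (n + 1 + r)) * sq 0 r = p powi (2 * (n + 1)) * sq 2 r" for r
    using powi_mult_theta_term[of "2 * (n + 1)" "2" r 0] by (simp add: algebra_simps)
  have "bilat q n n (sq 0) = bilat q n (n + 1) (\<lambda>r. sq 0 r - p powi (2 * (n + 1)) * sq 2 r)"
    using bilat_right[of n "n + 1" "sq 0"]
    by (simp only: left_diff_distrib mult_1_left * add_diff_cancel_right')
  then show ?thesis
    unfolding bilat_diff bilat_cmult bilat_theta_term_2_odd by simp
qed

lemma bilat_theta_term_0_rec: "bilat q (n - 1) (n - 1) (sq 0) = (1 - p powi (4 * n)) * bilat q n n (sq 0)"
proof -
  have *: "p powi (2 * (n - r)) * sq 0 r = p powi (2 * n) * sq (-2) r" for r
    using powi_mult_theta_term[of "2 * n" "- 2" r 0] by (simp add: algebra_simps)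
  have "bilat q (n - 1) (n - 1) (sq 0) = bilat q (n - 1) n (sq 0)"
    using bilat_theta_term_0_odd[of "n - 1"] by simp
  also have "\<dots> = bilat q n n (sq 0) - p powi (2 * n) * bilat q n n (sq (-2))"
    unfolding bilat_left by (simp only: left_diff_distrib mult_1_left * bilat_diff bilat_cmult)
  also have "bilat q n n (sq (-2)) = bilat q n n (sq 2)"
    by (subst bilat_reflect) (simp add: theta_term_uminus)
  finally show ?thesis
    unfolding bilat_theta_term_2 using powi_add[of "2 * n" "2 * n"] by (simp add: algebra_simps)
qed

lemma bilat_theta_term_0: "bilat q (int n) (int n) (sq 0) = 1 / (qpoch q q n * qpoch (- q) q n)"
proof (induction n)
  case 0
  then show ?case by (simp add: bilat_single theta_term_def)
next
  case (Suc n)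
  have "p powi (4 * int (Suc n)) = q ^ 2 * (q ^ 2) ^ n"
    by (simp add: power_int_def nat_mult_distrib nat_add_distrib power_mult[symmetric] power_add[symmetric])
  then have "bilat q (int (Suc n)) (int (Suc n)) (sq 0) * (1 - q\<^sup>2 * (q\<^sup>2) ^ n) = 1 / qpoch (q\<^sup>2) (q\<^sup>2) n"
    using bilat_theta_term_0_rec[of "int (Suc n)"] Suc by (simp add: qpoch_mult_minus mult.commute)
  moreover have "1 - q\<^sup>2 * (q\<^sup>2) ^ n \<noteq> 0"
    by (rule qpoch_factor_nonzero) (use q_less in \<open>auto simp: norm_power power_less_one_iff\<close>)
  ultimately show ?case
    unfolding qpoch_mult_minus unfolding qpoch_Suc by (rule eq_recip_mult)
qed

text \<open>Reflection exchanges \<open>c = 1\<close> and \<open>c = 3\<close> up to powers of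
  \<open>p\<close>, so \<open>sq 1 + p * sq 3\<close> is antisymmetric. This turns the
  \<open>c = 3\<close> correction from raising the index into a multiple of the sum with
  \<open>c = 1\<close>.\<close>

lemma bilat_theta_term_1_even: "(1 + p powi (2 * n + 1)) * bilat q n (n + 1) (sq 1) = bilat q n n (sq 1)"
proof -
  have *: "p powi (2 * (n + 1 + r)) * sq 1 r = p powi (2 * (n + 1)) * sq 3 r" for r
    using powi_mult_theta_term[of "2 * (n + 1)" "2" r 1] by (simp add: algebra_simps)
  have pp: "p powi (2 * (n + 1)) = p powi (2 * n + 1) * p"
    using powi_add[of "2 * n + 1" 1] by (simp add: distrib_left add.commute)
  have "bilat q n (n + 1) (\<lambda>r. sq 1 r + p * sq 3 r) = 0"
    by (rule bilat_antisym_odd) (use p_nz in \<open>simp add: theta_term_reflect power_int_minus field_simps\<close>)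
  then have z: "bilat q n (n + 1) (sq 1) = - (p * bilat q n (n + 1) (sq 3))"
    by (simp add: bilat_add bilat_cmult eq_neg_iff_add_eq_0)
  have "bilat q n n (sq 1) = bilat q n (n + 1) (\<lambda>r. sq 1 r - p powi (2 * (n + 1)) * sq 3 r)"
    using bilat_right[of n "n + 1" "sq 1"]
    by (simp only: left_diff_distrib mult_1_left * add_diff_cancel_right')
  then show ?thesis
    unfolding bilat_diff bilat_cmult pp using z by (simp add: algebra_simps)
qed

text \<open>Here the correction has \<open>c = -1\<close>, and \<open>r \<mapsto> -r\<close> brings
  it back to \<open>c = 1\<close>.\<close>

lemma bilat_theta_term_1_odd: "(1 - p powi (2 * n)) * bilat q n n (sq 1) = bilat q (n - 1) n (sq 1)"
proof -
  have *: "p powi (2 * (n - r)) * sq 1 r = p powi (2 * n) * sq (-1) r" for r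
    using powi_mult_theta_term[of "2 * n" "- 2" r 1] by (simp add: algebra_simps)
  have "bilat q (n - 1) n (sq 1) = bilat q n n (sq 1) - p powi (2 * n) * bilat q n n (sq (-1))"
    unfolding bilat_left by (simp only: left_diff_distrib mult_1_left * bilat_diff bilat_cmult)
  also have "bilat q n n (sq (-1)) = bilat q n n (sq 1)"
    by (subst bilat_reflect) (simp add: theta_term_uminus)
  finally show ?thesis by (simp add: algebra_simps)
qed

text \<open>The two preceding recurrences alternate along the index pairs \<open>(n, n)\<close>,
  \<open>(n, n + 1)\<close>, \<open>(n + 1, n + 1)\<close>, and so on.\<close>

lemma bilat_theta_term_1:
  "bilat q (int n) (int n) (sq 1) = 1 / (qpoch q q n * qpoch (- p) q n)"
  "bilat q (int n) (int n + 1) (sq 1) = 1 / (qpoch q q n * qpoch (- p) q (Suc n))"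
proof -
  have nz: "1 + p * q ^ n \<noteq> 0" "1 - q * q ^ n \<noteq> 0" "qpoch q q n \<noteq> 0" "qpoch (- p) q n \<noteq> 0" for n
    using qpoch_factor_nonzero[of q "- p" n] qpoch_factor_nonzero[of q q n]
      qpoch_nonzero[of q q] qpoch_nonzero[of q "-p"] q_less p_less by auto
  have pw: "p powi (2 * int n + 1) = p * q ^ n" for n
    using p_nz by (simp add: power_int_add power_int_double[symmetric])
  have ev: "bilat q (int n) (int n + 1) (sq 1) = 1 / (qpoch q q n * qpoch (- p) q (Suc n))"
    if "bilat q (int n) (int n) (sq 1) = 1 / (qpoch q q n * qpoch (- p) q n)" for n
  proof -
    have "bilat q (int n) (int n + 1) (sq 1) * (1 + p * q ^ n) = 1 / (qpoch q q n * qpoch (- p) q n)"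
      using bilat_theta_term_1_even[of "int n"] that unfolding pw by (simp add: mult.commute)
    from eq_recip_mult[OF this nz(1)] show ?thesis
      by (simp add: qpoch_Suc mult_ac)
  qed
  show *: "bilat q (int n) (int n) (sq 1) = 1 / (qpoch q q n * qpoch (- p) q n)"
  proof (induction n)
    case 0
    then show ?case by (simp add: bilat_single theta_term_def)
  next
    case (Suc n)
    have "p powi (2 * int (Suc n)) = q * q ^ n"
      by (subst power_int_double[symmetric]) (simp only: power_int_of_nat power_Suc)
    with bilat_theta_term_1_odd[of "int (Suc n)"] ev[OF Suc]
    have "bilat q (int (Suc n)) (int (Suc n)) (sq 1) * (1 - q * q ^ n) = 1 / (qpoch q q n * qpoch (- p) q (Suc n))"
      by (simp add: mult.commute add.commute)
    from eq_recip_mult[OF this nz(2)] show ?case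
      by (simp add: qpoch_Suc mult_ac)
  qed
  show "bilat q (int n) (int n + 1) (sq 1) = 1 / (qpoch q q n * qpoch (- p) q (Suc n))"
    by (rule ev[OF *])
qed

text \<open>Finite Bailey lemma. After exchanging the sums, the sum over \<open>n\<close> for fixed
  \<open>r\<close> is \<open>q_vandermonde\<close> with \<open>k = n - r\<close>,
  \<open>M = N - r\<close>, \<open>d = 2r + e\<close>, because
  \<open>n(n + e) - r(r + e) = (n - r)(n + r + e)\<close>.\<close>

lemma bailey_finite:
  assumes "e \<in> {0, 1}"
  shows "(\<Sum>n\<le>N. p powi (2 * int n * (int n + e)) * iq (int N - int n) * bilat q (int n) (int n + e) \<alpha>)
    = bilat q (int N) (int N + e) (\<lambda>r. p powi (2 * r * (r + e)) * \<alpha> r)"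
proof -
  have inner: "(\<Sum>n\<le>N. p powi (2 * int n * (int n + e)) * iq (int N - int n) * iq (int n - r) * iq (int n + e + r))
      = p powi (2 * r * (r + e)) * iq (int N - r) * iq (int N + e + r)" for r
  proof -
    let ?f = "\<lambda>n. p powi (2 * (n - r) * (n + r + e)) * iq (n - r) * iq (int N - n) * iq (n + r + e)"
    have "iq (int N - r) * iq (int N - r + (2 * r + e))
      = bilat q (int N - r) (2 * r + e) (\<lambda>k. p powi (2 * k * (k + (2 * r + e))) * iq k)"
      by (rule q_vandermonde[symmetric])
    also have "\<dots> = (\<Sum>\<^sub>\<infinity>n. ?f n)"
      unfolding bilat_def
      by (rule infsum_reindex_bij_witness[of _ "\<lambda>n. n - r" "\<lambda>n. n + r"]) (auto simp: algebra_simps)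
    \<comment> \<open>A nonzero term has \<open>n \<ge> r\<close> and \<open>n \<ge> -r - e\<close>,
      so \<open>2n \<ge> -e \<ge> -1\<close>, which forces \<open>n \<ge> 0\<close>.\<close>
    also have "\<dots> = infsum ?f {0..int N}"
      by (rule infsum_cong_neutral) (use assms in \<open>auto simp: qfact_inv_def\<close>)
    also have "\<dots> = (\<Sum>n\<in>{0..int N}. ?f n)"
      by simp
    also have "\<dots> = (\<Sum>n\<le>N. ?f (int n))"
      by (rule sum.reindex_bij_witness[of _ int nat]) auto
    finally have "p powi (2 * r * (r + e)) * (iq (int N - r) * iq (int N - r + (2 * r + e)))
      = (\<Sum>n\<le>N. p powi (2 * r * (r + e)) * ?f (int n))"
      by (simp add: sum_distrib_left)
    also have "\<dots> = (\<Sum>n\<le>N. p powi (2 * int n * (int n + e)) * iq (int N - int n) * iq (int n - r) * iq (int n + e + r))"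
    proof (rule sum.cong[OF refl])
      fix n
      have "p powi (2 * int n * (int n + e)) = p powi (2 * r * (r + e)) * p powi (2 * (int n - r) * (int n + r + e))"
        unfolding powi_add[symmetric] by (simp add: algebra_simps)
      then show "p powi (2 * r * (r + e)) * ?f (int n)
        = p powi (2 * int n * (int n + e)) * iq (int N - int n) * iq (int n - r) * iq (int n + e + r)"
        by (simp add: mult_ac add_ac)
    qed
    finally show ?thesis
      by (simp add: algebra_simps)
  qed
  have "((\<lambda>r. \<Sum>n\<le>N. p powi (2 * int n * (int n + e)) * iq (int N - int n) * (\<alpha> r * iq (int n - r) * iq (int n + e + r))) has_sum
    (\<Sum>n\<le>N. p powi (2 * int n * (int n + e)) * iq (int N - int n) * bilat q (int n) (int n + e) \<alpha>)) UNIV"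
    by (intro has_sum_finite_sum has_sum_cmult_right bilat_has_sum) auto
  also have "(\<lambda>r. \<Sum>n\<le>N. p powi (2 * int n * (int n + e)) * iq (int N - int n) * (\<alpha> r * iq (int n - r) * iq (int n + e + r)))
    = (\<lambda>r. (p powi (2 * r * (r + e)) * \<alpha> r) * iq (int N - r) * iq (int N + e + r))"
  proof
    fix r
    have "(\<Sum>n\<le>N. p powi (2 * int n * (int n + e)) * iq (int N - int n) * (\<alpha> r * iq (int n - r) * iq (int n + e + r)))
      = \<alpha> r * (\<Sum>n\<le>N. p powi (2 * int n * (int n + e)) * iq (int N - int n) * iq (int n - r) * iq (int n + e + r))"
      by (simp add: sum_distrib_left mult_ac)
    then show "(\<Sum>n\<le>N. p powi (2 * int n * (int n + e)) * iq (int N - int n) * (\<alpha> r * iq (int n - r) * iq (int n + e + r)))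
       = (p powi (2 * r * (r + e)) * \<alpha> r) * iq (int N - r) * iq (int N + e + r)"
      unfolding inner by (simp add: mult_ac)
  qed
  finally show ?thesis
    by (rule has_sum_unique) (rule bilat_has_sum)
qed

section \<open>From triple sums to theta series\<close>

lemma norm_powi_le_1: "m \<ge> 0 \<Longrightarrow> norm (p powi m) \<le> 1"
  using p_less by (simp add: norm_power_int power_int_le_one)

text \<open>For fixed \<open>N = i + j\<close>, \<open>bailey_finite\<close> performs the sum over
  \<open>i\<close> and produces a new bilateral sum. Absolute convergence then permits summing over
  \<open>N\<close> first, which gives \<open>W r\<close>, and over \<open>r\<close> last, which
  gives \<open>S\<close>.\<close>

lemma bailey_double:
  assumes e: "e \<in> {0, 1}"
    and \<alpha>: "(\<lambda>r. norm (\<alpha> r)) summable_on UNIV"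
    and w: "(\<lambda>N. norm (w N)) summable_on UNIV"
    and W: "\<And>r. ((\<lambda>N. w N * iq (int N - r) * iq (int N + e + r)) has_sum W r) UNIV"
    and S: "((\<lambda>r. p powi (2 * r * (r + e)) * \<alpha> r * W r) has_sum S) UNIV"
    and f: "f summable_on UNIV"
    and f_eq: "\<And>i j. f (i, j) = w (i + j) * p powi (2 * int i * (int i + e)) * iq (int j) * bilat q (int i) (int i + e) \<alpha>"
  shows "(f has_sum S) UNIV"
proof -
  obtain C where C: "C \<ge> 1" "\<And>m. norm (iq m) \<le> C"
    using qfact_inv_bounded[OF q_less] by metis
  define \<alpha>' where "\<alpha>' = (\<lambda>r. p powi (2 * r * (r + e)) * \<alpha> r)"
  have \<alpha>': "norm (\<alpha>' r) \<le> norm (\<alpha> r)" for r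
  proof -
    \<comment> \<open>For an integer \<open>r\<close> and \<open>e \<in> {0, 1}\<close> the factors
      \<open>r\<close> and \<open>r + e\<close> never have opposite signs.\<close>
    have "2 * r * (r + e) \<ge> 0"
      using e by (auto simp: mult_nonneg_nonneg mult_nonpos_nonpos zero_le_mult_iff)
    from norm_powi_le_1[OF this] show ?thesis
      unfolding \<alpha>'_def norm_mult by (rule mult_left_le_one_le[rotated 2]) auto
  qed
  define h where "h = (\<lambda>(r, N). w N * (\<alpha>' r * iq (int N - r) * iq (int N + e + r)))"
  have "(\<lambda>(r, N). norm (\<alpha> r) * norm (w N) * (C * C)) summable_on UNIV \<times> UNIV"
  proof -
    have "(\<lambda>(r, N). norm (\<alpha> r) * norm (w N)) summable_on UNIV \<times> UNIV"
      by (rule summable_on_SigmaI[where g = "\<lambda>r. norm (\<alpha> r) * (\<Sum>\<^sub>\<infinity>N. norm (w N))"])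
        (use w \<alpha> in \<open>auto intro!: has_sum_cmult_right summable_on_cmult_left\<close>)
    then have "(\<lambda>x. (case x of (r, N) \<Rightarrow> norm (\<alpha> r) * norm (w N)) * (C * C)) summable_on UNIV \<times> UNIV"
      by (rule summable_on_cmult_left)
    then show ?thesis by (simp add: case_prod_unfold)
  qed
  moreover have "norm (h x) \<le> (case x of (r, N) \<Rightarrow> norm (\<alpha> r) * norm (w N) * (C * C))" for x
  proof (cases x)
    case (Pair r N)
    have "norm (w N) * (norm (\<alpha>' r) * norm (iq (int N - r)) * norm (iq (int N + e + r)))
      \<le> norm (w N) * (norm (\<alpha> r) * C * C)"
      using C \<alpha>' by (intro mult_mono mult_nonneg_nonneg) auto
    then show ?thesis by (simp add: Pair h_def norm_mult mult_ac)
  qed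
  ultimately have "(\<lambda>x. norm (h x)) summable_on UNIV \<times> UNIV"
    by (rule Infinite_Sum.abs_summable_on_comparison_test')
  then have h: "h summable_on UNIV \<times> UNIV"
    by (rule abs_summable_summable)
  have "(h has_sum S) (UNIV \<times> UNIV)"
  proof (rule has_sum_SigmaI[OF _ S h])
    fix r
    show "((\<lambda>N. h (r, N)) has_sum p powi (2 * r * (r + e)) * \<alpha> r * W r) UNIV"
      using has_sum_cmult_right[OF W, of "\<alpha>' r" r] by (simp add: h_def \<alpha>'_def mult_ac)
  qed
  then have hs: "((\<lambda>(N, r). h (r, N)) has_sum S) (UNIV \<times> UNIV)"
    by (subst (asm) has_sum_swap)
  have N: "((\<lambda>N. w N * bilat q (int N) (int N + e) \<alpha>') has_sum S) UNIV"
    by (rule has_sum_Sigma'[OF hs]) (auto simp: h_def intro!: has_sum_cmult_right bilat_has_sum)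
  have bij: "bij_betw (\<lambda>(N, n). (n, N - n)) (SIGMA N:UNIV. {..N}) (UNIV :: (nat \<times> nat) set)"
    by (rule bij_betwI[of _ _ _ "\<lambda>(i, j). (i + j, i)"]) auto
  have "((\<lambda>x. f (case x of (N, n) \<Rightarrow> (n, N - n))) has_sum S) (SIGMA N:UNIV. {..N})"
  proof (rule has_sum_SigmaI[OF _ N])
    show "(\<lambda>x. f (case x of (N, n) \<Rightarrow> (n, N - n))) summable_on (SIGMA N:UNIV. {..N})"
      using summable_on_reindex_bij_betw[OF bij, of f] f by simp
    fix N
    have "w N * bilat q (int N) (int N + e) \<alpha>' = (\<Sum>n\<le>N. f (n, N - n))"
      unfolding \<alpha>'_def bailey_finite[OF e, symmetric] sum_distrib_left
      by (intro sum.cong) (auto simp: f_eq of_nat_diff mult_ac)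
    then show "((\<lambda>n. f (case (N, n) of (N, n) \<Rightarrow> (n, N - n))) has_sum w N * bilat q (int N) (int N + e) \<alpha>') {..N}"
      by (intro has_sum_finiteI) auto
  qed
  then show ?thesis
    using has_sum_reindex_bij_betw[OF bij, of f] by simp
qed

lemma vandermonde_shift:
  "((\<lambda>N. p powi (2 * N * (N + e)) * iq (N - r) * iq (N + e + r)) has_sum p powi (2 * r * (r + e)) / qpoch_inf q q) UNIV"
proof -
  have eq: "p powi (2 * N * (N + e)) * iq (N - r) * iq (N + e + r)
    = p powi (2 * r * (r + e)) * (p powi (2 * (N - r) * ((N - r) + (2 * r + e))) * iq (N - r) * iq ((2 * r + e) + (N - r)))" for N
    unfolding mult.assoc[symmetric] powi_add[symmetric] by (simp add: algebra_simps)
  have "((\<lambda>N. p powi (2 * (N - r) * ((N - r) + (2 * r + e))) * iq (N - r) * iq ((2 * r + e) + (N - r)))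
    has_sum 1 / qpoch_inf q q) UNIV"
    using vandermonde_inf[of "2 * r + e"]
    by (subst has_sum_reindex_bij_betw[of "\<lambda>N. N - r" UNIV UNIV])
      (auto intro!: bij_betwI[of _ _ _ "\<lambda>N. N + r"])
  from has_sum_cmult_right[OF this, of "p powi (2 * r * (r + e))"]
  show ?thesis unfolding eq by simp
qed

lemma weight_sum:
  assumes "e \<in> {0, 1}"
  shows "((\<lambda>N. p powi (2 * int N * (int N + e)) * iq (int N - r) * iq (int N + e + r)) has_sum
    p powi (2 * r * (r + e)) / qpoch_inf q q) UNIV"
  by (rule has_sum_int_restrict_nat[OF vandermonde_shift]) (use assms in \<open>auto simp: qfact_inv_def\<close>)

lemma weight_sum_shifted:
  "((\<lambda>N. p powi (2 * int N * (int N - 1)) * iq (int N - r) * iq (int N + r)) has_sum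
    (p powi (2 * r * (r - 1)) + p powi (2 * r * (r + 1))) / qpoch_inf q q) UNIV"
proof -
  have "((\<lambda>N. p powi (- 2 * r) * (p powi (2 * N * (N + 0)) * iq (N - r) * iq (N + 0 + r))
      + p powi (2 * N * (N + (- 1))) * iq (N - (r + 1)) * iq (N + (- 1) + (r + 1))) has_sum
    p powi (- 2 * r) * (p powi (2 * r * (r + 0)) / qpoch_inf q q) + p powi (2 * (r + 1) * ((r + 1) + (- 1))) / qpoch_inf q q) UNIV"
    by (intro has_sum_add has_sum_cmult_right vandermonde_shift)
  moreover have "p powi (- 2 * r) * (p powi (2 * N * (N + 0)) * iq (N - r) * iq (N + 0 + r))
      + p powi (2 * N * (N + (- 1))) * iq (N - (r + 1)) * iq (N + (- 1) + (r + 1))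
    = p powi (2 * N * (N - 1)) * iq (N - r) * iq (N + r)" for N
  proof -
    have *: "iq (N - (r + 1)) = (1 - p powi (2 * (N - r))) * iq (N - r)"
      unfolding iq_rec by (simp add: algebra_simps)
    have "p powi (- 2 * r) * p powi (2 * N * N) = p powi (2 * N * (N - 1)) * p powi (2 * (N - r))"
      unfolding powi_add[symmetric] by (simp add: algebra_simps)
    then show ?thesis unfolding * by (simp add: algebra_simps)
  qed
  moreover have "p powi (- 2 * r) * (p powi (2 * r * (r + 0)) / qpoch_inf q q) + p powi (2 * (r + 1) * ((r + 1) + (- 1))) / qpoch_inf q q
    = (p powi (2 * r * (r - 1)) + p powi (2 * r * (r + 1))) / qpoch_inf q q"
  proof -
    have "p powi (- 2 * r) * p powi (2 * r * r) = p powi (2 * r * (r - 1))"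
      unfolding powi_add[symmetric] by (simp add: algebra_simps)
    then show ?thesis by (simp add: add_divide_distrib mult_ac)
  qed
  ultimately have "((\<lambda>N. p powi (2 * N * (N - 1)) * iq (N - r) * iq (N + r)) has_sum
    (p powi (2 * r * (r - 1)) + p powi (2 * r * (r + 1))) / qpoch_inf q q) UNIV"
    by simp
  then show ?thesis
    by (rule has_sum_int_restrict_nat) (auto simp: qfact_inv_def)
qed

section \<open>Absolute convergence of theta series, weights and triple sums\<close>

lemma theta_term_norm_summable: "(\<lambda>r. norm (sq c r)) summable_on UNIV"
proof -
  have "sq c r = (- (p powi c)) powi r * q powi (r\<^sup>2)" for r
  proof -
    have "(- (p powi c)) powi r = (-1) powi r * (p powi c) powi r"
      using power_int_mult_distrib[of "-1" "p powi c" r] by simp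
    then show ?thesis
      by (simp add: theta_term_def power_int_double powi_add power_int_mult[symmetric] del: power_int_mult_numeral)
  qed
  then show ?thesis
    using theta_norm_summable[of q "- (p powi c)"] q_less p_nz by simp
qed

lemma weight_norm_summable:
  assumes "e \<ge> - 1"
  shows "(\<lambda>N. norm (p powi (2 * int N * (int N + e)))) summable_on UNIV"
proof (rule Infinite_Sum.abs_summable_on_comparison_test')
  show "(\<lambda>N::nat. norm p powi (- 1) * norm p ^ N) summable_on UNIV"
    using p_less by (intro summable_on_cmult_right summable_on_geometric_nat) auto
  fix N
  have "2 * int N * (int N + e) \<ge> 2 * int N * (int N - 1)"
    using assms by (intro mult_left_mono) auto
  moreover have "2 * int N * (int N - 1) \<ge> int N - 1"
  proof (cases N)
    case (Suc m)
    have "int m * int m + int m \<ge> 0" by simp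
    then show ?thesis by (simp add: Suc algebra_simps)
  qed simp
  ultimately have "norm p powi (2 * int N * (int N + e)) \<le> norm p powi (int N - 1)"
    using p_less p_nz by (intro power_int_decreasing) auto
  then show "norm (p powi (2 * int N * (int N + e))) \<le> norm p powi (- 1) * norm p ^ N"
    using p_nz by (simp add: norm_power_int power_int_diff power_int_minus field_simps)
qed

text \<open>The exponent is at least \<open>i + j + k - 2\<close> and the reciprocal factorials are
  bounded, so a product of three geometric series dominates.\<close>

lemma tsum3_summable:
  assumes "A \<ge> - 2" "B \<ge> - 2" "C \<ge> 0"
  shows "tsum3 p (texp A B C) summable_on UNIV"
proof -
  obtain K where K: "K \<ge> 1" "\<And>m. norm (iq m) \<le> K"
    using qfact_inv_bounded[OF q_less] by metis
  define c where "c = norm p"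
  have c: "0 < c" "c < 1" using p_less p_nz by (auto simp: c_def)
  have g: "(\<lambda>n::nat. c ^ n) summable_on UNIV"
    using c by (intro summable_on_geometric_nat) auto
  have sum2: "(\<lambda>(j, k). c ^ j * c ^ k) summable_on (UNIV \<times> UNIV :: (nat \<times> nat) set)"
    by (rule summable_on_SigmaI[where g = "\<lambda>j. c ^ j * (\<Sum>\<^sub>\<infinity>k. c ^ k)"])
      (use g c in \<open>auto intro!: has_sum_cmult_right summable_on_cmult_left\<close>)
  have "(\<lambda>(i, x). c ^ i * (case x of (j, k) \<Rightarrow> c ^ j * c ^ k)) summable_on (UNIV \<times> UNIV :: (nat \<times> nat \<times> nat) set)"
    by (rule summable_on_SigmaI[where g = "\<lambda>i. c ^ i * (\<Sum>\<^sub>\<infinity>(j, k). c ^ j * c ^ k)"])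
      (use g sum2 c in \<open>auto intro!: has_sum_cmult_right summable_on_cmult_left\<close>)
  from summable_on_cmult_right[OF this, of "c powi (- 2) * K ^ 3"]
  have "(\<lambda>x. c powi (- 2) * K ^ 3 * (case x of (i, j, k) \<Rightarrow> c ^ i * (c ^ j * c ^ k))) summable_on UNIV"
    by (simp add: case_prod_unfold)
  then have "(\<lambda>x. norm (tsum3 p (texp A B C) x)) summable_on UNIV"
  proof (rule Infinite_Sum.abs_summable_on_comparison_test')
    fix x :: "nat \<times> nat \<times> nat"
    obtain i j k where x: "x = (i, j, k)" by (cases x)
    have "int i \<le> 4 * int i * int i - 2 * int i"
    proof (cases i)
      case (Suc m)
      have "int m * int m + int m \<ge> 0" by simp
      then show ?thesis by (simp add: Suc algebra_simps)
    qed simp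
    moreover have "int j - 2 \<le> 2 * int j * int j - 2 * int j"
    proof (cases j)
      case (Suc m)
      have "2 * (int m * int m) + int m \<ge> 0" by simp
      then show ?thesis by (simp add: Suc algebra_simps)
    qed simp
    moreover have "int k \<le> int k * int k"
      by (cases k) (auto simp: algebra_simps)
    moreover have "A * int i \<ge> - 2 * int i" "B * int j \<ge> - 2 * int j" "C * int k \<ge> 0"
      using assms mult_right_mono[of "- 2" A "int i"] mult_right_mono[of "- 2" B "int j"] by auto
    moreover have "4 * int i * int j \<ge> 0" "2 * int i * int k \<ge> 0" by auto
    ultimately have "texp A B C i j k \<ge> int i + int j + int k - 2"
      unfolding texp_def power2_eq_square by linarith
    then have "c powi (texp A B C i j k) \<le> c powi (int i + int j + int k - 2)"
      using c by (intro power_int_decreasing) auto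
    also have "\<dots> = c powi (- 2) * (c ^ i * (c ^ j * c ^ k))"
      using c by (simp add: power_int_diff power_int_add power_int_minus field_simps)
    finally have 1: "norm (p powi (texp A B C i j k)) \<le> c powi (- 2) * (c ^ i * (c ^ j * c ^ k))"
      by (simp add: c_def norm_power_int)
    have "norm (tsum3 p (texp A B C) x)
      = norm (p powi (texp A B C i j k)) * (norm (iq (int i)) * norm (iq (int j)) * norm (iq (int k)))"
      by (simp add: tsum3_def x qfact_inv_of_nat norm_mult norm_divide)
    also have "\<dots> \<le> (c powi (- 2) * (c ^ i * (c ^ j * c ^ k))) * (K * K * K)"
      using 1 K c by (intro mult_mono mult_nonneg_nonneg) auto
    finally show "norm (tsum3 p (texp A B C) x) \<le> c powi (- 2) * K ^ 3 * (case x of (i, j, k) \<Rightarrow> c ^ i * (c ^ j * c ^ k))"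
      by (simp add: x power3_eq_cube mult_ac)
  qed
  then show ?thesis by (rule abs_summable_summable)
qed

section \<open>Reduction to a double sum and the Bailey lemma\<close>

text \<open>Euler's identity at \<open>y = p ^ (2 * i + C)\<close> sums over \<open>k\<close>; the
  resulting product is split off at its first \<open>i\<close> factors, which produces
  \<open>qpoch (- (p ^ Suc C)) q i\<close> in the denominator. Summability of \<open>G\<close>
  follows from that of the triple sum, so the premise on \<open>S\<close> may assume it.\<close>

lemma tsum3_reduce:
  assumes AB: "A \<ge> - 2" "B \<ge> - 2"
    and G: "\<And>i j. G (i, j) = p powi (4 * (int i)\<^sup>2 + 2 * (int j)\<^sup>2 + 4 * int i * int j + A * int i + B * int j)
        / (qpoch q q i * qpoch (- (p ^ Suc C)) q i * qpoch q q j)"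
    and S: "G summable_on UNIV \<Longrightarrow> (G has_sum S) UNIV"
  shows "(tsum3 p (texp A B (int C)) has_sum (qpoch_inf (- (p ^ Suc C)) q * S)) UNIV"
proof -
  let ?X = "qpoch_inf (- (p ^ Suc C)) q"
  have pC: "norm (- (p ^ Suc C)) < 1"
    using p_less by (simp add: norm_power power_less_one_iff del: power_Suc)
  then have X: "?X \<noteq> 0"
    by (intro qpoch_inf_nonzero q_less)
  have bij: "bij_betw (\<lambda>x. (fst (fst x), snd (fst x), snd x)) (UNIV \<times> UNIV) (UNIV :: (nat \<times> nat \<times> nat) set)"
    by (rule bij_betwI[of _ _ _ "\<lambda>(i, j, k). ((i, j), k)"]) auto
  define F where "F = (\<lambda>x. tsum3 p (texp A B (int C)) (fst (fst x), snd (fst x), snd x))"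
  have F: "F summable_on UNIV \<times> UNIV"
    unfolding F_def using summable_on_reindex_bij_betw[OF bij, of "tsum3 p (texp A B (int C))"]
      tsum3_summable[OF AB, of "int C"] by simp
  have inner: "((\<lambda>k. F (x, k)) has_sum ?X * G x) UNIV" for x
  proof -
    obtain i j where x: "x = (i, j)" by (cases x)
    let ?E = "4 * (int i)\<^sup>2 + 2 * (int j)\<^sup>2 + 4 * int i * int j + A * int i + B * int j"
    have ij: "qpoch (- (p ^ Suc C)) q i \<noteq> 0"
      using pC by (intro qpoch_nonzero q_less)
    have "((\<lambda>k. p powi ?E / (qpoch q q i * qpoch q q j) * ((p ^ (2 * i + C)) ^ k * p ^ (k\<^sup>2) / qpoch q q k)) has_sum
      p powi ?E / (qpoch q q i * qpoch q q j) * qpoch_inf (- (p ^ (2 * i + C)) * p) q) UNIV"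
      using p_nz by (intro has_sum_cmult_right euler_has_sum) auto
    also have "(\<lambda>k. p powi ?E / (qpoch q q i * qpoch q q j) * ((p ^ (2 * i + C)) ^ k * p ^ (k\<^sup>2) / qpoch q q k)) = (\<lambda>k. F (x, k))"
    proof
      fix k
      have "p powi (texp A B (int C) i j k) = p powi ?E * p powi int ((2 * i + C) * k + k\<^sup>2)"
        unfolding powi_add[symmetric] by (simp add: texp_def algebra_simps)
      also have "p powi int ((2 * i + C) * k + k\<^sup>2) = (p ^ (2 * i + C)) ^ k * p ^ (k\<^sup>2)"
        unfolding power_int_of_nat by (simp only: power_add power_mult)
      finally show "p powi ?E / (qpoch q q i * qpoch q q j) * ((p ^ (2 * i + C)) ^ k * p ^ (k\<^sup>2) / qpoch q q k) = F (x, k)"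
        by (simp add: F_def x tsum3_def mult_ac)
    qed
    also have "- (p ^ (2 * i + C)) * p = - (p ^ Suc C) * q ^ i"
      by (simp add: power_add mult_ac flip: power_mult)
    also have "p powi ?E / (qpoch q q i * qpoch q q j) * qpoch_inf (- (p ^ Suc C) * q ^ i) q = ?X * G x"
      unfolding x G qpoch_inf_split[OF q_less, of "- (p ^ Suc C)" i] using ij by (simp add: mult_ac)
    finally show ?thesis .
  qed
  have "(\<lambda>x. ?X * G x) summable_on UNIV"
    using summable_on_SigmaD[OF F has_sum_imp_summable[OF inner]] infsumI[OF inner] by simp
  then have "G summable_on UNIV"
    using X summable_on_cmult_right'[of ?X G UNIV] by simp
  then have "((\<lambda>x. ?X * G x) has_sum ?X * S) UNIV"
    by (intro has_sum_cmult_right S)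
  then have "(F has_sum ?X * S) (UNIV \<times> UNIV)"
    using has_sum_SigmaI[OF inner _ F] by blast
  then show ?thesis
    unfolding F_def using has_sum_reindex_bij_betw[OF bij, of "tsum3 p (texp A B (int C))"] by simp
qed

text \<open>With \<open>N = i + j\<close> the quadratic part is
  \<open>2N\<^sup>2 + 2i\<^sup>2\<close>, and the linear part is
  \<open>2bN + 2ei + (A - 2b - 2e)i\<close>. The last summand is what \<open>\<beta>\<close> must
  absorb.\<close>

lemma tsum3_bailey:
  assumes A: "A \<ge> - 2" and b: "b \<ge> - 1" and e: "e \<in> {0, 1}"
    and \<alpha>: "(\<lambda>r. norm (\<alpha> r)) summable_on UNIV"
    and \<beta>: "\<And>i. p powi ((A - 2 * b - 2 * e) * int i) / (qpoch q q i * qpoch (- (p ^ Suc C)) q i)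
        = bilat q (int i) (int i + e) \<alpha>"
    and W: "\<And>r. ((\<lambda>N. p powi (2 * int N * (int N + b)) * iq (int N - r) * iq (int N + e + r)) has_sum W r) UNIV"
    and S: "((\<lambda>r. p powi (2 * r * (r + e)) * \<alpha> r * W r) has_sum S) UNIV"
  shows "(tsum3 p (texp A (2 * b) (int C)) has_sum (qpoch_inf (- (p ^ Suc C)) q * S)) UNIV"
proof -
  define G where "G = (\<lambda>(i, j). p powi (4 * (int i)\<^sup>2 + 2 * (int j)\<^sup>2 + 4 * int i * int j + A * int i + (2 * b) * int j)
        / (qpoch q q i * qpoch (- (p ^ Suc C)) q i * qpoch q q j))"
  show ?thesis
  proof (rule tsum3_reduce)
    show "A \<ge> - 2" "2 * b \<ge> - 2" using A b by auto
    show "G (i, j) = p powi (4 * (int i)\<^sup>2 + 2 * (int j)\<^sup>2 + 4 * int i * int j + A * int i + (2 * b) * int j)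
        / (qpoch q q i * qpoch (- (p ^ Suc C)) q i * qpoch q q j)" for i j
      by (simp add: G_def)
    assume G: "G summable_on UNIV"
    show "(G has_sum S) UNIV"
    proof (rule bailey_double[OF e \<alpha> weight_norm_summable[OF b] W S G])
      fix i j
      have "p powi (4 * (int i)\<^sup>2 + 2 * (int j)\<^sup>2 + 4 * int i * int j + A * int i + (2 * b) * int j)
        = p powi (2 * int (i + j) * (int (i + j) + b)) * p powi (2 * int i * (int i + e)) * p powi ((A - 2 * b - 2 * e) * int i)"
        unfolding powi_add[symmetric] by (simp add: power2_eq_square algebra_simps)
      then show "G (i, j) = p powi (2 * int (i + j) * (int (i + j) + b)) * p powi (2 * int i * (int i + e)) * iq (int j)
          * bilat q (int i) (int i + e) \<alpha>"
        unfolding \<beta>[symmetric] by (simp add: G_def qfact_inv_of_nat mult_ac del: power_Suc)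
    qed
  qed
qed

text \<open>The triple product with nome \<open>p ^ 6\<close> and
  \<open>y = - (p powi c)\<close>.\<close>

lemma theta_6:
  "((\<lambda>r. (-1) powi r * p powi (6 * r\<^sup>2 + c * r)) has_sum
    qpoch_inf (p ^ 12) (p ^ 12) * qpoch_inf (p powi (6 + c)) (p ^ 12) * qpoch_inf (p powi (6 - c)) (p ^ 12)) UNIV"
proof -
  have "norm (p ^ 6) < 1"
    using p_less by (simp add: norm_power power_less_one_iff)
  then have "((\<lambda>r. (- (p powi c)) powi r * (p ^ 6) powi r\<^sup>2) has_sum
    qpoch_inf ((p ^ 6)\<^sup>2) ((p ^ 6)\<^sup>2) * qpoch_inf (- (- (p powi c)) * p ^ 6) ((p ^ 6)\<^sup>2)
      * qpoch_inf (- (p ^ 6) / - (p powi c)) ((p ^ 6)\<^sup>2)) UNIV"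
    using p_nz by (intro nome.jacobi_triple_product nome.intro) auto
  moreover have "(- (p powi c)) powi r * (p ^ 6) powi r\<^sup>2 = (-1) powi r * p powi (6 * r\<^sup>2 + c * r)" for r
  proof -
    have "(- (p powi c)) powi r = (-1) powi r * (p powi c) powi r"
      using power_int_mult_distrib[of "-1" "p powi c" r] by simp
    moreover have "(p ^ 6) powi r\<^sup>2 = p powi (6 * r\<^sup>2)"
      by (simp add: power_int_power)
    ultimately show ?thesis
      by (simp only: powi_add power_int_mult[of p c r] mult_ac)
  qed
  moreover have "- (- (p powi c)) * p ^ 6 = p powi (6 + c)" "- (p ^ 6) / - (p powi c) = p powi (6 - c)"
    using p_nz by (simp_all add: power_int_add power_int_diff)
  ultimately show ?thesis by (simp flip: power_mult)
qed

text \<open>The case \<open>b = e\<close>: each of the two Vandermonde summations contributes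
  \<open>2r(r + e)\<close> to the exponent \<open>2r\<^sup>2 + cr\<close> of
  \<open>\<alpha>\<^sub>r\<close>, giving \<open>6r\<^sup>2 + (4e + c)r\<close>. The constant
  \<open>D\<close> allows for a pair known only up to normalization.\<close>

lemma tsum3_bailey_theta:
  assumes A: "A \<ge> - 2" and e: "e \<in> {0, 1}"
    and \<beta>: "\<And>i. p powi ((A - 4 * e) * int i) / (qpoch q q i * qpoch (- (p ^ Suc C)) q i)
        = D * bilat q (int i) (int i + e) (sq c)"
  shows "(tsum3 p (texp A (2 * e) (int C)) has_sum (qpoch_inf (- (p ^ Suc C)) q *
    (D * (qpoch_inf (p ^ 12) (p ^ 12) * qpoch_inf (p powi (6 + 4 * e + c)) (p ^ 12) * qpoch_inf (p powi (6 - 4 * e - c)) (p ^ 12))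
      / qpoch_inf q q))) UNIV"
proof (rule tsum3_bailey[OF A _ e, where \<alpha> = "\<lambda>r. D * sq c r"])
  show "e \<ge> - 1" using e by auto
  show "(\<lambda>r. norm (D * sq c r)) summable_on UNIV"
    unfolding norm_mult by (intro summable_on_cmult_right theta_term_norm_summable)
  show "p powi ((A - 2 * e - 2 * e) * int i) / (qpoch q q i * qpoch (- (p ^ Suc C)) q i)
        = bilat q (int i) (int i + e) (\<lambda>r. D * sq c r)" for i
    unfolding bilat_cmult \<beta>[symmetric] by simp
  show "((\<lambda>N. p powi (2 * int N * (int N + e)) * iq (int N - r) * iq (int N + e + r)) has_sum
    p powi (2 * r * (r + e)) / qpoch_inf q q) UNIV" for r
    by (rule weight_sum[OF e])
  have eq: "p powi (2 * r * (r + e)) * (D * sq c r) * (p powi (2 * r * (r + e)) / qpoch_inf q q)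
    = D / qpoch_inf q q * ((-1) powi r * p powi (6 * r\<^sup>2 + (4 * e + c) * r))" for r
  proof -
    have "6 * r\<^sup>2 + (4 * e + c) * r = 2 * r * (r + e) + 2 * r * (r + e) + (2 * r\<^sup>2 + c * r)"
      by (simp add: power2_eq_square algebra_simps)
    then show ?thesis
      unfolding theta_term_def by (simp only: powi_add) (simp add: mult_ac)
  qed
  show "((\<lambda>r. p powi (2 * r * (r + e)) * (D * sq c r) * (p powi (2 * r * (r + e)) / qpoch_inf q q)) has_sum
    D * (qpoch_inf (p ^ 12) (p ^ 12) * qpoch_inf (p powi (6 + 4 * e + c)) (p ^ 12) * qpoch_inf (p powi (6 - 4 * e - c)) (p ^ 12))
      / qpoch_inf q q) UNIV"
    using has_sum_cmult_right[OF theta_6[of "4 * e + c"], of "D / qpoch_inf q q"]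
    unfolding eq by (simp add: add.assoc diff_diff_add mult.assoc)
qed

section \<open>The six sums obtained from Bailey pairs\<close>

text \<open>Here \<open>b = -1\<close> while \<open>e = 0\<close>, so the weight sum has two terms.
  They give theta series with \<open>c = -2\<close> and \<open>c = 2\<close>, whose products
  coincide; this is the source of the factor 2.\<close>

lemma tsum3_texp_m2_m2_1:
  "(tsum3 p (texp (-2) (-2) 1) has_sum (qpoch_inf (- q) q *
    (2 * (qpoch_inf (p ^ 12) (p ^ 12) * qpoch_inf (p ^ 8) (p ^ 12) * qpoch_inf (p ^ 4) (p ^ 12)) / qpoch_inf q q))) UNIV"
proof -
  let ?T = "qpoch_inf (p ^ 12) (p ^ 12) * qpoch_inf (p ^ 8) (p ^ 12) * qpoch_inf (p ^ 4) (p ^ 12)"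
  let ?W = "\<lambda>r. (p powi (2 * r * (r - 1)) + p powi (2 * r * (r + 1))) / qpoch_inf q q"
  have "((\<lambda>r. (1 / qpoch_inf q q) * ((-1) powi r * p powi (6 * r\<^sup>2 + (- 2) * r) + (-1) powi r * p powi (6 * r\<^sup>2 + 2 * r)))
    has_sum (1 / qpoch_inf q q) * (?T + ?T)) UNIV"
    using theta_6[of "-2"] theta_6[of 2]
    by (intro has_sum_cmult_right has_sum_add) (simp_all add: mult_ac)
  moreover have "p powi (2 * r * (r + 0)) * sq 0 r * ?W r
    = (1 / qpoch_inf q q) * ((-1) powi r * p powi (6 * r\<^sup>2 + (- 2) * r) + (-1) powi r * p powi (6 * r\<^sup>2 + 2 * r))" for r
  proof -
    have "p powi (6 * r\<^sup>2 + (- 2) * r) = p powi (2 * r * (r + 0)) * p powi (2 * r\<^sup>2) * p powi (2 * r * (r - 1))"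
      "p powi (6 * r\<^sup>2 + 2 * r) = p powi (2 * r * (r + 0)) * p powi (2 * r\<^sup>2) * p powi (2 * r * (r + 1))"
      unfolding powi_add[symmetric] by (simp_all add: power2_eq_square algebra_simps)
    then show ?thesis
      by (simp add: theta_term_def algebra_simps add_divide_distrib)
  qed
  ultimately have S: "((\<lambda>r. p powi (2 * r * (r + 0)) * sq 0 r * ?W r) has_sum 2 * ?T / qpoch_inf q q) UNIV"
    by (simp only: mult_2[symmetric]) simp
  have "(tsum3 p (texp (-2) (2 * (- 1)) (int 1)) has_sum (qpoch_inf (- (p ^ Suc 1)) q * (2 * ?T / qpoch_inf q q))) UNIV"
  proof (rule tsum3_bailey[OF _ _ _ theta_term_norm_summable _ _ S])
    show "p powi ((- 2 - 2 * - 1 - 2 * 0) * int i) / (qpoch q q i * qpoch (- (p ^ Suc 1)) q i) = bilat q (int i) (int i + 0) (sq 0)" for i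
      using bilat_theta_term_0[of i] by (simp add: numeral_2_eq_2)
    show "((\<lambda>N. p powi (2 * int N * (int N + - 1)) * iq (int N - r) * iq (int N + 0 + r)) has_sum ?W r) UNIV" for r
      using weight_sum_shifted[of r] by simp
  qed auto
  then show ?thesis by (simp add: numeral_2_eq_2)
qed

text \<open>The leftover \<open>p powi (2 * int i)\<close> in \<open>\<beta>\<close> is what
  distinguishes the pair with \<open>c = 2\<close> from the one with \<open>c = 0\<close>.\<close>

lemma tsum3_texp_2_0_1:
  "(tsum3 p (texp 2 0 1) has_sum (qpoch_inf (- q) q *
    (qpoch_inf (p ^ 12) (p ^ 12) * qpoch_inf (p ^ 8) (p ^ 12) * qpoch_inf (p ^ 4) (p ^ 12) / qpoch_inf q q))) UNIV"
proof -
  have "p powi ((2 - 4 * 0) * int i) / (qpoch q q i * qpoch (- (p ^ Suc 1)) q i)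
     = 1 * bilat q (int i) (int i + 0) (sq 2)" for i
    unfolding Suc_1 by (simp add: bilat_theta_term_2 bilat_theta_term_0)
  from tsum3_bailey_theta[OF _ _ this] show ?thesis by (simp add: numeral_2_eq_2)
qed

lemma tsum3_texp_0_0_1:
  "(tsum3 p (texp 0 0 1) has_sum (qpoch_inf (- q) q *
    (qpoch_inf (p ^ 12) (p ^ 12) * qpoch_inf (p ^ 6) (p ^ 12) * qpoch_inf (p ^ 6) (p ^ 12) / qpoch_inf q q))) UNIV"
proof -
  have "p powi ((0 - 4 * 0) * int i) / (qpoch q q i * qpoch (- (p ^ Suc 1)) q i)
     = 1 * bilat q (int i) (int i + 0) (sq 0)" for i
    unfolding Suc_1 by (simp add: bilat_theta_term_0)
  from tsum3_bailey_theta[OF _ _ this] show ?thesis by (simp add: numeral_2_eq_2)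
qed

lemma tsum3_texp_4_2_1:
  "(tsum3 p (texp 4 2 1) has_sum (qpoch_inf (- q) q *
    (qpoch_inf (p ^ 12) (p ^ 12) * qpoch_inf (p ^ 10) (p ^ 12) * qpoch_inf (p ^ 2) (p ^ 12) / qpoch_inf q q))) UNIV"
proof -
  have "p powi ((4 - 4 * 1) * int i) / (qpoch q q i * qpoch (- (p ^ Suc 1)) q i)
     = 1 * bilat q (int i) (int i + 1) (sq 0)" for i
    unfolding Suc_1 by (simp add: bilat_theta_term_0_odd bilat_theta_term_0)
  from tsum3_bailey_theta[OF _ _ this] show ?thesis by (simp add: numeral_2_eq_2)
qed

lemma tsum3_texp_0_0_0:
  "(tsum3 p (texp 0 0 0) has_sum (qpoch_inf (- p) q *
    (qpoch_inf (p ^ 12) (p ^ 12) * qpoch_inf (p ^ 7) (p ^ 12) * qpoch_inf (p ^ 5) (p ^ 12) / qpoch_inf q q))) UNIV"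
proof -
  have "p powi ((0 - 4 * 0) * int i) / (qpoch q q i * qpoch (- (p ^ Suc 0)) q i)
     = 1 * bilat q (int i) (int i + 0) (sq 1)" for i
    by (simp add: bilat_theta_term_1)
  from tsum3_bailey_theta[OF _ _ this] show ?thesis by simp
qed

lemma tsum3_texp_4_2_2:
  "(tsum3 p (texp 4 2 2) has_sum (qpoch_inf (- p) q *
    (qpoch_inf (p ^ 12) (p ^ 12) * qpoch_inf (p ^ 11) (p ^ 12) * qpoch_inf p (p ^ 12) / qpoch_inf q q))) UNIV"
proof -
  have p1: "1 + p \<noteq> 0"
    using qpoch_factor_nonzero[OF q_less, of "-p" 0] p_less by simp
  have "p powi ((4 - 4 * 1) * int i) / (qpoch q q i * qpoch (- (p ^ Suc 2)) q i)
     = (1 + p) * bilat q (int i) (int i + 1) (sq 1)" for i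
  proof -
    have "- p * q ^ 1 = - (p ^ Suc 2)" "qpoch (- p) q 1 = 1 + p"
      by (simp_all add: qpoch_def power2_eq_square power3_eq_cube)
    with qpoch_add[of "- p" q 1 i] have "qpoch (- p) q (Suc i) = (1 + p) * qpoch (- (p ^ Suc 2)) q i"
      by (simp only: plus_1_eq_Suc)
    then show ?thesis
      using p1 by (simp add: bilat_theta_term_1 del: power_Suc)
  qed
  from tsum3_bailey_theta[OF _ _ this]
  have "(tsum3 p (texp 4 2 2) has_sum (qpoch_inf (- (p ^ 3)) q * ((1 + p) *
    (qpoch_inf (p ^ 12) (p ^ 12) * qpoch_inf (p ^ 11) (p ^ 12) * qpoch_inf p (p ^ 12)) / qpoch_inf q q))) UNIV"
    by simp
  moreover have "qpoch_inf (- p) q = (1 + p) * qpoch_inf (- (p ^ 3)) q"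
    using qpoch_inf_split[OF q_less, of "- p" 1] by (simp add: qpoch_Suc power2_eq_square power3_eq_cube mult.assoc)
  ultimately show ?thesis by (simp add: mult_ac)
qed

section \<open>The second identity: collecting terms with 2i + j = m\<close>

definition pair_term :: "int \<Rightarrow> int \<Rightarrow> int \<Rightarrow> complex" where
  "pair_term c m i = qfact_inv (q\<^sup>2) i * p powi ((m - 2 * i) * (m - 2 * i + c)) * iq (m - 2 * i)"

lemma pair_term_summable: "pair_term c m summable_on UNIV"
proof (rule finite_nonzero_values_imp_summable_on)
  have "{i \<in> UNIV. pair_term c m i \<noteq> 0} \<subseteq> {0..m}"
    by (auto simp: pair_term_def qfact_inv_def split: if_splits)
  then show "finite {i \<in> UNIV. pair_term c m i \<noteq> 0}"
    by (rule finite_subset) simp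
qed

lemma pair_sum_rec:
  "infsum (pair_term (-1) m) UNIV = infsum (pair_term 1 m) UNIV + infsum (pair_term 1 (m - 1)) UNIV"
  "(1 - p powi (2 * m)) * infsum (pair_term (-1) m) UNIV
    = infsum (pair_term 1 (m - 1)) UNIV + infsum (pair_term 1 (m - 2)) UNIV"
proof -
  have j: "p powi (j * (j - 1)) * iq (j - 1) = (1 - p powi (2 * j)) * (p powi (j * (j + -1)) * iq j)"
    "p powi (2 * j) * p powi (j * (j + -1)) = p powi (j * (j + 1))" for j
    unfolding iq_rec[symmetric] powi_add[symmetric] by (simp_all add: algebra_simps)
  have 1: "pair_term 1 (m - 1) i
      = qfact_inv (q\<^sup>2) i * ((1 - p powi (2 * (m - 2 * i))) * (p powi ((m - 2 * i) * (m - 2 * i + -1)) * iq (m - 2 * i)))" for i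
    unfolding j(1)[symmetric] by (simp add: pair_term_def algebra_simps)
  have 2: "pair_term 1 m i = qfact_inv (q\<^sup>2) i * (p powi (2 * (m - 2 * i)) * p powi ((m - 2 * i) * (m - 2 * i + -1))) * iq (m - 2 * i)" for i
    unfolding j(2) by (simp add: pair_term_def)
  have "pair_term (-1) m i = pair_term 1 m i + pair_term 1 (m - 1) i" for i
    unfolding 1 2 by (simp add: pair_term_def algebra_simps)
  then show "infsum (pair_term (-1) m) UNIV = infsum (pair_term 1 m) UNIV + infsum (pair_term 1 (m - 1)) UNIV"
    using infsum_add[OF pair_term_summable pair_term_summable, of 1 m 1 "m - 1"] by presburger
  have "norm (q\<^sup>2) < 1"
    using q_less by (simp add: norm_power power_less_one_iff)
  then have i2: "(1 - p powi (4 * i)) * qfact_inv (q\<^sup>2) i = qfact_inv (q\<^sup>2) (i - 1)" for i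
    using qfact_inv_rec[of "q\<^sup>2" i] p_nz by (simp add: power_int_power)
  have 3: "pair_term 1 (m - 2) (i - 1) = (1 - p powi (4 * i)) * pair_term 1 m i" for i
    unfolding pair_term_def i2[symmetric] by (simp add: algebra_simps)
  have 4: "p powi (2 * m) = p powi (2 * (m - 2 * i)) * p powi (4 * i)" for i
    unfolding powi_add[symmetric] by (simp add: algebra_simps)
  have 5: "(1 - p powi (2 * m)) * pair_term (-1) m i = pair_term 1 (m - 1) i + pair_term 1 (m - 2) (i - 1)" for i
    unfolding 1 2 3 4[of i] by (simp add: pair_term_def algebra_simps)
  have bij: "bij_betw (\<lambda>i::int. i - 1) UNIV UNIV"
    by (rule bij_betwI[of _ _ _ "\<lambda>i. i + 1"]) auto
  have "(\<lambda>i. pair_term 1 (m - 2) (i - 1)) summable_on UNIV"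
    using summable_on_reindex_bij_betw[OF bij, of "pair_term 1 (m - 2)"] pair_term_summable by simp
  then have "infsum (\<lambda>i. (1 - p powi (2 * m)) * pair_term (-1) m i) UNIV
     = infsum (pair_term 1 (m - 1)) UNIV + infsum (\<lambda>i. pair_term 1 (m - 2) (i - 1)) UNIV"
    unfolding 5 by (intro infsum_add pair_term_summable)
  then show "(1 - p powi (2 * m)) * infsum (pair_term (-1) m) UNIV
    = infsum (pair_term 1 (m - 1)) UNIV + infsum (pair_term 1 (m - 2)) UNIV"
    by (simp add: infsum_cmult_right' infsum_reindex_bij_betw[OF bij])
qed

text \<open>The second relation at \<open>m\<close> and the first at \<open>m - 1\<close> have the
  same right side; eliminating it leaves the recurrence of \<open>iq\<close>.\<close>

lemma pair_sum: "infsum (pair_term (-1) (int m)) UNIV = iq (int m)"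
proof (induction m)
  case 0
  have "infsum (pair_term (-1) (int 0)) UNIV = infsum (pair_term (-1) 0) {0}"
    by (rule infsum_cong_neutral) (auto simp: pair_term_def qfact_inv_def)
  also have "\<dots> = 1" by (simp add: pair_term_def)
  finally show ?case by simp
next
  case (Suc m)
  let ?M = "int (Suc m)"
  have "(1 - p powi (2 * ?M)) * infsum (pair_term (-1) ?M) UNIV = infsum (pair_term (-1) (?M - 1)) UNIV"
    using pair_sum_rec(2)[of ?M] pair_sum_rec(1)[of "?M - 1"] by simp
  also have "\<dots> = (1 - p powi (2 * ?M)) * iq ?M"
    unfolding iq_rec using Suc by simp
  finally show ?case
    using one_minus_powi_nonzero[of "2 * ?M"] by simp
qed

lemma tsum3_texp_0_m1_1:
  "(tsum3 p (texp 0 (-1) 1) has_sum (qpoch_inf (- q) q * qpoch_inf (- p) q)) UNIV"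
proof -
  define G where "G = (\<lambda>(i, j). p powi (4 * (int i)\<^sup>2 + 2 * (int j)\<^sup>2 + 4 * int i * int j + 0 * int i + (- 1) * int j)
        / (qpoch q q i * qpoch (- q) q i * qpoch q q j))"
  have bij: "bij_betw (\<lambda>x. (snd x, fst x - 2 * snd x)) (SIGMA m:UNIV. {..m div 2}) (UNIV :: (nat \<times> nat) set)"
    by (rule bij_betwI[of _ _ _ "\<lambda>(i, j). (2 * i + j, i)"]) auto
  have euler: "((\<lambda>m. p ^ (m\<^sup>2) / qpoch q q m) has_sum qpoch_inf (- p) q) UNIV"
    using euler_has_sum[of 1] by simp
  have "(tsum3 p (texp 0 (-1) (int 1)) has_sum (qpoch_inf (- (p ^ Suc 1)) q * qpoch_inf (- p) q)) UNIV"
  proof (rule tsum3_reduce)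
    show "G (i, j) = p powi (4 * (int i)\<^sup>2 + 2 * (int j)\<^sup>2 + 4 * int i * int j + 0 * int i + (- 1) * int j)
        / (qpoch q q i * qpoch (- (p ^ Suc 1)) q i * qpoch q q j)" for i j
      unfolding Suc_1 by (simp add: G_def)
    assume G: "G summable_on UNIV"
    have "((\<lambda>x. G (snd x, fst x - 2 * snd x)) has_sum qpoch_inf (- p) q) (SIGMA m:UNIV. {..m div 2})"
    proof (rule has_sum_SigmaI[OF _ euler])
      show "(\<lambda>x. G (snd x, fst x - 2 * snd x)) summable_on (SIGMA m:UNIV. {..m div 2})"
        using summable_on_reindex_bij_betw[OF bij, of G] G by simp
      fix m :: nat
      have eq: "G (i, m - 2 * i) = p ^ (m\<^sup>2) * pair_term (-1) (int m) (int i)" if "i \<le> m div 2" for i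
      proof -
        define j where "j = m - 2 * i"
        have m: "m = 2 * i + j" using that by (auto simp: j_def)
        have "p powi (4 * (int i)\<^sup>2 + 2 * (int j)\<^sup>2 + 4 * int i * int j + 0 * int i + (- 1) * int j)
          = p powi int (m\<^sup>2) * p powi (int j * (int j + -1))"
          unfolding powi_add[symmetric] m by (simp add: power2_eq_square algebra_simps)
        then show ?thesis
          unfolding j_def[symmetric] G_def prod.case qpoch_mult_minus power_int_of_nat
          by (simp add: pair_term_def m qfact_inv_of_nat)
      qed
      have "iq (int m) = infsum (pair_term (-1) (int m)) {0..int (m div 2)}"
        unfolding pair_sum[symmetric] by (rule infsum_cong_neutral) (auto simp: pair_term_def qfact_inv_def)
      also have "\<dots> = (\<Sum>i\<le>m div 2. pair_term (-1) (int m) (int i))"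
        unfolding infsum_finite[OF finite_atLeastAtMost_int]
        by (rule sum.reindex_bij_witness[of _ int nat]) auto
      finally have "p ^ (m\<^sup>2) * iq (int m) = (\<Sum>i\<le>m div 2. G (i, m - 2 * i))"
        by (simp add: eq flip: sum_distrib_left)
      then show "((\<lambda>i. G (snd (m, i), fst (m, i) - 2 * snd (m, i))) has_sum p ^ (m\<^sup>2) / qpoch q q m) {..m div 2}"
        by (intro has_sum_finiteI) (auto simp: qfact_inv_of_nat)
    qed
    then show "(G has_sum qpoch_inf (- p) q) UNIV"
      using has_sum_reindex_bij_betw[OF bij, of G] by simp
  qed auto
  then show ?thesis by (simp add: numeral_2_eq_2)
qed

end

section \<open>Product evaluations\<close>

context
  fixes q :: complex
  assumes q: "norm q < 1"
begin

lemma q_power_less: "n > 0 \<Longrightarrow> norm (q ^ n) < 1"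
  using q by (simp add: norm_power power_less_one_iff)

lemma qpoch_inf_power_nonzero: "m > 0 \<Longrightarrow> n > 0 \<Longrightarrow> qpoch_inf (q ^ m) (q ^ n) \<noteq> 0"
  by (intro qpoch_inf_nonzero q_power_less)

text \<open>Brings every product to a common base, \<open>q ^ 6\<close> or \<open>q ^ 12\<close>,
  where the identities reduce to cancellation of residue classes.\<close>

lemma qpoch_inf_power_dissect:
  assumes "n > 0" "d > 0"
  shows "qpoch_inf (q ^ m) (q ^ n) = (\<Prod>j<d. qpoch_inf (q ^ (m + n * j)) (q ^ (n * d)))"
  using qpoch_inf_dissect[OF q_power_less[OF assms(1)] assms(2), of "q ^ m"]
  by (simp add: power_add power_mult)

lemma qpoch_inf_1_1_mod_6:
  "qpoch_inf q q = qpoch_inf q (q ^ 6) * qpoch_inf (q ^ 2) (q ^ 6) * qpoch_inf (q ^ 3) (q ^ 6)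
    * qpoch_inf (q ^ 4) (q ^ 6) * qpoch_inf (q ^ 5) (q ^ 6) * qpoch_inf (q ^ 6) (q ^ 6)"
  using qpoch_inf_power_dissect[of 1 6 1] by (simp add: eval_nat_numeral lessThan_Suc mult_ac)

lemma qpoch_inf_2_2_mod_6:
  "qpoch_inf (q ^ 2) (q ^ 2) = qpoch_inf (q ^ 2) (q ^ 6) * qpoch_inf (q ^ 4) (q ^ 6) * qpoch_inf (q ^ 6) (q ^ 6)"
  using qpoch_inf_power_dissect[of 2 3 2] by (simp add: eval_nat_numeral lessThan_Suc mult_ac)

lemma qpoch_inf_3_3_mod_6:
  "qpoch_inf (q ^ 3) (q ^ 3) = qpoch_inf (q ^ 3) (q ^ 6) * qpoch_inf (q ^ 6) (q ^ 6)"
  using qpoch_inf_power_dissect[of 3 2 3] by (simp add: eval_nat_numeral lessThan_Suc mult_ac)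

lemma qpoch_inf_minus_q: "qpoch_inf (- q) q = qpoch_inf (q ^ 2) (q ^ 2) / qpoch_inf q q"
  using qpoch_inf_mult_minus[OF q, of q] qpoch_inf_power_nonzero[of 1 1] by (simp add: field_simps)

lemma product_2_4_6_mod_6: "qpoch_inf (- q) q * (qpoch_inf (q ^ 6) (q ^ 6) * qpoch_inf (q ^ 4) (q ^ 6) * qpoch_inf (q ^ 2) (q ^ 6) / qpoch_inf q q)
   = qpoch_inf (q ^ 2) (q ^ 2) ^ 2 / qpoch_inf q q ^ 2"
  unfolding qpoch_inf_minus_q qpoch_inf_2_2_mod_6
  by (simp add: power_mult_distrib power2_eq_square[of "qpoch_inf a b" for a b] mult_ac)

lemma product_3_3_6_mod_6: "qpoch_inf (- q) q * (qpoch_inf (q ^ 6) (q ^ 6) * qpoch_inf (q ^ 3) (q ^ 6) * qpoch_inf (q ^ 3) (q ^ 6) / qpoch_inf q q)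
   = qpoch_inf (q ^ 2) (q ^ 2) * qpoch_inf (q ^ 3) (q ^ 3) ^ 2 / (qpoch_inf q q ^ 2 * qpoch_inf (q ^ 6) (q ^ 6))"
  unfolding qpoch_inf_minus_q using qpoch_inf_power_nonzero[of 6 6]
  by (simp add: qpoch_inf_3_3_mod_6 power2_eq_square mult_ac)

lemma product_1_5_6_mod_6: "qpoch_inf (- q) q * (qpoch_inf (q ^ 6) (q ^ 6) * qpoch_inf (q ^ 5) (q ^ 6) * qpoch_inf q (q ^ 6) / qpoch_inf q q)
   = qpoch_inf (q ^ 6) (q ^ 6) ^ 2 / (qpoch_inf q q * qpoch_inf (q ^ 3) (q ^ 3))"
  unfolding qpoch_inf_minus_q qpoch_inf_1_1_mod_6 qpoch_inf_2_2_mod_6 qpoch_inf_3_3_mod_6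
  using qpoch_inf_power_nonzero[of 1 6] qpoch_inf_power_nonzero[of 2 6] qpoch_inf_power_nonzero[of 3 6]
    qpoch_inf_power_nonzero[of 4 6] qpoch_inf_power_nonzero[of 5 6] qpoch_inf_power_nonzero[of 6 6]
  by (simp add: divide_simps power2_eq_square)

text \<open>The quotient \<open>(q\<^sup>2;q\<^sup>4)\<^sub>\<infinity> /
  (q;q\<^sup>2)\<^sub>\<infinity>\<close>, with both products dissected modulo 12.\<close>

lemma qpoch_inf_minus_q_odd:
  "qpoch_inf (- q) (q ^ 2) = qpoch_inf (q ^ 2) (q ^ 12) * qpoch_inf (q ^ 6) (q ^ 12) * qpoch_inf (q ^ 10) (q ^ 12)
    / (qpoch_inf q (q ^ 12) * qpoch_inf (q ^ 3) (q ^ 12) * qpoch_inf (q ^ 5) (q ^ 12)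
      * qpoch_inf (q ^ 7) (q ^ 12) * qpoch_inf (q ^ 9) (q ^ 12) * qpoch_inf (q ^ 11) (q ^ 12))"
proof -
  have "qpoch_inf q (q ^ 2) * qpoch_inf (- q) (q ^ 2) = qpoch_inf (q ^ 2) (q ^ 4)"
    using qpoch_inf_mult_minus[OF q_power_less[of 2], of q] by simp
  also have "\<dots> = qpoch_inf (q ^ 2) (q ^ 12) * qpoch_inf (q ^ 6) (q ^ 12) * qpoch_inf (q ^ 10) (q ^ 12)"
    using qpoch_inf_power_dissect[of 4 3 2] by (simp add: eval_nat_numeral lessThan_Suc mult_ac)
  moreover have "qpoch_inf q (q ^ 2) = qpoch_inf q (q ^ 12) * qpoch_inf (q ^ 3) (q ^ 12) * qpoch_inf (q ^ 5) (q ^ 12)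
      * qpoch_inf (q ^ 7) (q ^ 12) * qpoch_inf (q ^ 9) (q ^ 12) * qpoch_inf (q ^ 11) (q ^ 12)"
    using qpoch_inf_power_dissect[of 2 6 1] by (simp add: eval_nat_numeral lessThan_Suc mult_ac)
  moreover have "qpoch_inf q (q ^ 2) \<noteq> 0"
    using qpoch_inf_power_nonzero[of 1 2] by simp
  ultimately show ?thesis
    by (metis nonzero_mult_div_cancel_left)
qed

lemma qpoch_inf_2_2_mod_12:
  "qpoch_inf (q ^ 2) (q ^ 2) = qpoch_inf (q ^ 2) (q ^ 12) * qpoch_inf (q ^ 4) (q ^ 12) * qpoch_inf (q ^ 6) (q ^ 12)
    * qpoch_inf (q ^ 8) (q ^ 12) * qpoch_inf (q ^ 10) (q ^ 12) * qpoch_inf (q ^ 12) (q ^ 12)"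
  using qpoch_inf_power_dissect[of 2 6 2] by (simp add: eval_nat_numeral lessThan_Suc mult_ac)

lemma product_5_7_12_mod_12:
  "qpoch_inf (- q) (q ^ 2) * (qpoch_inf (q ^ 12) (q ^ 12) * qpoch_inf (q ^ 7) (q ^ 12) * qpoch_inf (q ^ 5) (q ^ 12)
      / qpoch_inf (q ^ 2) (q ^ 2))
   = 1 / (qpoch_inf q (q ^ 12) * qpoch_inf (q ^ 3) (q ^ 12) * qpoch_inf (q ^ 4) (q ^ 12)
      * qpoch_inf (q ^ 8) (q ^ 12) * qpoch_inf (q ^ 9) (q ^ 12) * qpoch_inf (q ^ 11) (q ^ 12))"
  and product_1_11_12_mod_12:
  "qpoch_inf (- q) (q ^ 2) * (qpoch_inf (q ^ 12) (q ^ 12) * qpoch_inf (q ^ 11) (q ^ 12) * qpoch_inf q (q ^ 12)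
      / qpoch_inf (q ^ 2) (q ^ 2))
   = 1 / (qpoch_inf (q ^ 3) (q ^ 12) * qpoch_inf (q ^ 4) (q ^ 12) * qpoch_inf (q ^ 5) (q ^ 12)
      * qpoch_inf (q ^ 7) (q ^ 12) * qpoch_inf (q ^ 8) (q ^ 12) * qpoch_inf (q ^ 9) (q ^ 12))"
proof -
  have "qpoch_inf q (q ^ 12) \<noteq> 0" "m > 0 \<Longrightarrow> qpoch_inf (q ^ m) (q ^ 12) \<noteq> 0" for m
    using qpoch_inf_power_nonzero[of 1 12] qpoch_inf_power_nonzero[of m 12] by auto
  then show
    "qpoch_inf (- q) (q ^ 2) * (qpoch_inf (q ^ 12) (q ^ 12) * qpoch_inf (q ^ 7) (q ^ 12) * qpoch_inf (q ^ 5) (q ^ 12)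
        / qpoch_inf (q ^ 2) (q ^ 2))
     = 1 / (qpoch_inf q (q ^ 12) * qpoch_inf (q ^ 3) (q ^ 12) * qpoch_inf (q ^ 4) (q ^ 12)
        * qpoch_inf (q ^ 8) (q ^ 12) * qpoch_inf (q ^ 9) (q ^ 12) * qpoch_inf (q ^ 11) (q ^ 12))"
    "qpoch_inf (- q) (q ^ 2) * (qpoch_inf (q ^ 12) (q ^ 12) * qpoch_inf (q ^ 11) (q ^ 12) * qpoch_inf q (q ^ 12)
        / qpoch_inf (q ^ 2) (q ^ 2))
     = 1 / (qpoch_inf (q ^ 3) (q ^ 12) * qpoch_inf (q ^ 4) (q ^ 12) * qpoch_inf (q ^ 5) (q ^ 12)
        * qpoch_inf (q ^ 7) (q ^ 12) * qpoch_inf (q ^ 8) (q ^ 12) * qpoch_inf (q ^ 9) (q ^ 12))"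
    unfolding qpoch_inf_minus_q_odd qpoch_inf_2_2_mod_12 by (simp_all add: divide_simps)
qed

end

text \<open>Multiplying the left side by
  \<open>(s;q)\<^sub>\<infinity> (q;q)\<^sub>\<infinity>\<close> pairs each product with its
  negative and yields \<open>(q;q\<^sup>2)\<^sub>\<infinity>
  (q\<^sup>2;q\<^sup>2)\<^sub>\<infinity>\<close>, which is \<open>(q;q)\<^sub>\<infinity>\<close>
  again.\<close>

lemma product_minus_eq_recip:
  assumes "norm s < 1"
  shows "qpoch_inf (- (s\<^sup>2)) (s\<^sup>2) * qpoch_inf (- s) (s\<^sup>2) = 1 / qpoch_inf s (s\<^sup>2)"
proof -
  define q where "q = s\<^sup>2"
  have q: "norm q < 1" using assms by (simp add: q_def norm_power power_less_one_iff)
  have nz: "qpoch_inf s q \<noteq> 0" "qpoch_inf q q \<noteq> 0"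
    using qpoch_inf_nonzero[OF q assms] qpoch_inf_nonzero[OF q q] by simp_all
  have "qpoch_inf (- q) q * qpoch_inf (- s) q * (qpoch_inf s q * qpoch_inf q q)
    = qpoch_inf q (q\<^sup>2) * qpoch_inf (q\<^sup>2) (q\<^sup>2)"
    using qpoch_inf_mult_minus[OF q, of q] qpoch_inf_mult_minus[OF q, of s]
    by (simp add: q_def[symmetric] mult_ac)
  also have "\<dots> = qpoch_inf q q"
    using qpoch_inf_power_dissect[OF q, of 1 2 1] by (simp add: eval_nat_numeral lessThan_Suc mult_ac)
  finally show ?thesis
    using nz by (simp add: q_def[symmetric] field_simps)
qed

lemma qpoch_inf_0 [simp]: "qpoch_inf 0 q = 1"
  by (simp add: qpoch_inf_def)

text \<open>The case \<open>s = 0\<close> is separate because the locale above uses negative powers of \<open>p\<close>.\<close>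

lemma tsum3_zero:
  assumes "{(i, j, k). e i j k = 0} = Z" "finite Z" "c = of_nat (card Z)"
  shows "(tsum3 0 e has_sum c) UNIV"
proof (rule has_sum_finite_neutralI)
  show "finite Z" "Z \<subseteq> UNIV" by (use assms in auto)
  \<comment> \<open>Negative powers of zero are zero as well, since \<open>inverse 0 = 0\<close>, so
    the sum counts the zeros of the exponent.\<close>
  have t: "tsum3 0 e (i, j, k) = (if e i j k = 0 then 1 else 0)" for i j k
    by (simp add: tsum3_def qpoch_def power_int_0_left_if)
  then show "tsum3 0 e x = 0" if "x \<in> UNIV - Z" for x
    using that assms(1) by (cases x) auto
  have "sum (tsum3 0 e) Z = (\<Sum>x\<in>Z. 1)"
    using assms(1) t by (intro sum.cong) auto
  then show "c = sum (tsum3 0 e) Z" using assms by simp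
qed

lemma texp_eq_0_iff:
  assumes "A \<ge> - 2" "B \<ge> - 2" "C \<ge> 0"
  shows "texp A B C i j k = 0 \<longleftrightarrow> i = 0 \<and> k = 0 \<and> (j = 0 \<or> j = 1 \<and> B = - 2)"
proof
  assume *: "texp A B C i j k = 0"
  have "A * int i \<ge> - 2 * int i" "B * int j \<ge> - 2 * int j" "C * int k \<ge> 0"
    using assms mult_right_mono[of "- 2" A "int i"] mult_right_mono[of "- 2" B "int j"] by auto
  moreover have "4 * int i * int j \<ge> 0" "2 * int i * int k \<ge> 0" by auto
  moreover have sq: "int n \<le> int n * int n" for n
    by (cases n) (auto simp: algebra_simps)
  ultimately have ik: "i = 0" "k = 0"
    using * sq[of i] sq[of j] sq[of k] unfolding texp_def power2_eq_square by linarith+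
  with * have "int j * (2 * int j + B) = 0"
    by (simp add: texp_def power2_eq_square algebra_simps)
  with assms ik show "i = 0 \<and> k = 0 \<and> (j = 0 \<or> j = 1 \<and> B = - 2)"
    by auto
qed (auto simp: texp_def)

lemma tsum3_zero_texp:
  assumes "A \<ge> - 2" "B > - 2" "C \<ge> 0"
  shows "(tsum3 0 (texp A B C) has_sum 1) UNIV"
  by (rule tsum3_zero[where Z = "{(0, 0, 0)}"]) (use assms in \<open>auto simp: texp_eq_0_iff\<close>)

text \<open>For \<open>B = -2\<close> the exponent also vanishes at \<open>(0, 1, 0)\<close>; this
  matches the factor 2 in the first identity.\<close>

lemma tsum3_zero_texp_m2:
  assumes "A \<ge> - 2" "C \<ge> 0"
  shows "(tsum3 0 (texp A (- 2) C) has_sum 2) UNIV"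
  by (rule tsum3_zero[where Z = "{(0, 0, 0), (0, 1, 0)}"]) (use assms in \<open>auto simp: texp_eq_0_iff\<close>)

theorem theorem4p9:
  fixes s q :: complex
  assumes hs: "norm s < 1" and hq: "q = s ^ 2"
  shows
   "(tsum3 s (\<lambda>i j k. let i = int i; j = int j; k = int k in 4*i^2 + 2*j^2 + k^2 + 4*i*j + 2*i*k - 2*i - 2*j + k)
       has_sum (2 * qpoch_inf (q^2) (q^2) ^ 2 / qpoch_inf q q ^ 2)) UNIV \<and>
    (tsum3 s (\<lambda>i j k. let i = int i; j = int j; k = int k in 4*i^2 + 2*j^2 + k^2 + 4*i*j + 2*i*k - j + k)
       has_sum (1 / qpoch_inf s q)) UNIV \<and>
    (tsum3 s (\<lambda>i j k. let i = int i; j = int j; k = int k in 4*i^2 + 2*j^2 + k^2 + 4*i*j + 2*i*k + 2*i + k)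
       has_sum (qpoch_inf (q^2) (q^2) ^ 2 / qpoch_inf q q ^ 2)) UNIV \<and>
    (tsum3 s (\<lambda>i j k. let i = int i; j = int j; k = int k in 4*i^2 + 2*j^2 + k^2 + 4*i*j + 2*i*k + k)
       has_sum (qpoch_inf (q^2) (q^2) * qpoch_inf (q^3) (q^3) ^ 2
                / (qpoch_inf q q ^ 2 * qpoch_inf (q^6) (q^6)))) UNIV \<and>
    (tsum3 s (\<lambda>i j k. let i = int i; j = int j; k = int k in 4*i^2 + 2*j^2 + k^2 + 4*i*j + 2*i*k + 4*i + 2*j + k)
       has_sum (qpoch_inf (q^6) (q^6) ^ 2 / (qpoch_inf q q * qpoch_inf (q^3) (q^3)))) UNIV \<and>
    ((\<lambda>(i,j,k). q ^ (4*i^2 + 2*j^2 + k^2 + 4*i*j + 2*i*k)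
        / (qpoch (q^2) (q^2) i * qpoch (q^2) (q^2) j * qpoch (q^2) (q^2) k))
       has_sum (1 / (qpoch_inf q (q^12) * qpoch_inf (q^3) (q^12) * qpoch_inf (q^4) (q^12)
                   * qpoch_inf (q^8) (q^12) * qpoch_inf (q^9) (q^12) * qpoch_inf (q^11) (q^12)))) UNIV \<and>
    ((\<lambda>(i,j,k). q ^ (4*i^2 + 2*j^2 + k^2 + 4*i*j + 2*i*k + 4*i + 2*j + 2*k)
        / (qpoch (q^2) (q^2) i * qpoch (q^2) (q^2) j * qpoch (q^2) (q^2) k))
       has_sum (1 / (qpoch_inf (q^3) (q^12) * qpoch_inf (q^4) (q^12) * qpoch_inf (q^5) (q^12)
                   * qpoch_inf (q^7) (q^12) * qpoch_inf (q^8) (q^12) * qpoch_inf (q^9) (q^12)))) UNIV"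
proof -
  have q: "norm q < 1"
    using hs by (simp add: hq norm_power power_less_one_iff)
  have e: "(\<lambda>i j k. let i = int i; j = int j; k = int k in 4*i^2 + 2*j^2 + k^2 + 4*i*j + 2*i*k - 2*i - 2*j + k) = texp (- 2) (- 2) 1"
    "(\<lambda>i j k. let i = int i; j = int j; k = int k in 4*i^2 + 2*j^2 + k^2 + 4*i*j + 2*i*k - j + k) = texp 0 (- 1) 1"
    "(\<lambda>i j k. let i = int i; j = int j; k = int k in 4*i^2 + 2*j^2 + k^2 + 4*i*j + 2*i*k + 2*i + k) = texp 2 0 1"
    "(\<lambda>i j k. let i = int i; j = int j; k = int k in 4*i^2 + 2*j^2 + k^2 + 4*i*j + 2*i*k + k) = texp 0 0 1"
    "(\<lambda>i j k. let i = int i; j = int j; k = int k in 4*i^2 + 2*j^2 + k^2 + 4*i*j + 2*i*k + 4*i + 2*j + k) = texp 4 2 1"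
    by (auto simp: texp_def Let_def fun_eq_iff)
  have "texp 0 0 0 i j k = int (4*i^2 + 2*j^2 + k^2 + 4*i*j + 2*i*k)"
    "texp 4 2 2 i j k = int (4*i^2 + 2*j^2 + k^2 + 4*i*j + 2*i*k + 4*i + 2*j + 2*k)" for i j k
    by (simp_all add: texp_def)
  then have t: "(\<lambda>(i,j,k). q ^ (4*i^2 + 2*j^2 + k^2 + 4*i*j + 2*i*k)
        / (qpoch (q^2) (q^2) i * qpoch (q^2) (q^2) j * qpoch (q^2) (q^2) k)) = tsum3 q (texp 0 0 0)"
    "(\<lambda>(i,j,k). q ^ (4*i^2 + 2*j^2 + k^2 + 4*i*j + 2*i*k + 4*i + 2*j + 2*k)
        / (qpoch (q^2) (q^2) i * qpoch (q^2) (q^2) j * qpoch (q^2) (q^2) k)) = tsum3 q (texp 4 2 2)"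
    by (simp_all only: tsum3_def power_int_of_nat)
  show ?thesis
  proof (cases "s = 0")
    case True
    then show ?thesis
      unfolding e t by (simp add: hq tsum3_zero_texp tsum3_zero_texp_m2)
  next
    case False
    then have nz: "q \<noteq> 0" by (simp add: hq)
    have s: "s ^ 12 = q ^ 6" "s ^ 10 = q ^ 5" "s ^ 8 = q ^ 4" "s ^ 6 = q ^ 3" "s ^ 4 = q ^ 2" "s ^ 2 = q"
      by (simp_all add: hq flip: power_mult)
    have 1: "qpoch_inf (- q) q * (2 * (qpoch_inf (q ^ 6) (q ^ 6) * qpoch_inf (q ^ 4) (q ^ 6) * qpoch_inf (q ^ 2) (q ^ 6)) / qpoch_inf q q)
      = 2 * qpoch_inf (q^2) (q^2) ^ 2 / qpoch_inf q q ^ 2"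
      using arg_cong[OF product_2_4_6_mod_6[OF q], of "\<lambda>x. 2 * x"] by (simp add: mult_ac)
    \<comment> \<open>The first five sums use \<open>s\<close> as nome; the last two use
      \<open>q\<close> itself, since they are written in base \<open>q ^ 2\<close>.\<close>
    interpret s: nome s by (rule nome.intro[OF hs False])
    interpret q: nome q by (rule nome.intro[OF q nz])
    show ?thesis
      unfolding e t
      using s.tsum3_texp_m2_m2_1[unfolded s 1] s.tsum3_texp_0_m1_1[unfolded product_minus_eq_recip[OF hs], unfolded s]
        s.tsum3_texp_2_0_1[unfolded s product_2_4_6_mod_6[OF q]] s.tsum3_texp_0_0_1[unfolded s product_3_3_6_mod_6[OF q]]
        s.tsum3_texp_4_2_1[unfolded s product_1_5_6_mod_6[OF q]]
        q.tsum3_texp_0_0_0[unfolded product_5_7_12_mod_12[OF q]] q.tsum3_texp_4_2_2[unfolded product_1_11_12_mod_12[OF q]]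
      by (intro conjI)
  qed
qed

end
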